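(* There is an algorithm which, given a finite set $D\subseteq\mathbb{Z}^2$ and non-negative integers $b$ and $a$ such that the Laurent polynomial $g=f_D-(b-a)$ has line polynomial factors in at most one direction (up to parallelism), determines whether there exists a $(D,b,a)$-covering.
   Context: Write $X^{\vec{u}}=x^{u_1}y^{u_2}$. The characteristic polynomial of a finite $D\subseteq\mathbb{Z}^2$ is $f_D=\sum_{\vec{u}\in D}X^{-\vec{u}}$. A line polynomial in direction $\vec{v}$ (a non-zero vector of $\mathbb{Z}^2$) is a Laurent polynomial whose support (set of exponents with non-zero coefficients) has at least two points and is contained in $\vec{u}+\mathbb{Q}\vec{v}$ for some $\vec{u}$; directions $\vec{v},\vec{w}$ are parallel if $\vec{w}\in\mathbb{Q}\vec{v}$. Factors are taken in $\mathbb{C}[x^{\pm1},y^{\pm1}]$. A $(D,b,a)$-covering is a configuration $c\in\{0,1\}^{\mathbb{Z}^2}$ such that for every $\vec{u}\in\mathbb{Z}^2$ the restriction $c|_{\vec{u}+D}$ contains exactly $b$ ones if $c_{\vec{u}}=1$ and exactly $a$ ones if $c_{\vec{u}}=0$. *)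

theory Defs
  imports Complex_Main "HOL-Library.Poly_Mapping" "HOL-Library.Product_Plus"
    "HOL-Library.Nat_Bijection"
begin

text \<open>The ring of Laurent polynomials in two variables over the complex numbers is the
  group ring of the additive group of integer pairs: the coefficient at key \<open>(i, j)\<close> is that of
  \<open>x\<^sup>i y\<^sup>j\<close>, and multiplication is convolution.\<close>

type_synonym laurent2 = "(int \<times> int) \<Rightarrow>\<^sub>0 complex"

definition char_laurent :: "(int \<times> int) set \<Rightarrow> laurent2" where
  "char_laurent D = (\<Sum>u\<in>D. Poly_Mapping.single (- u) 1)"

definition laurent_const :: "complex \<Rightarrow> laurent2" where
  "laurent_const k = Poly_Mapping.single 0 k"

definition rat_span :: "int \<times> int \<Rightarrow> (rat \<times> rat) set" where
  "rat_span v = {(t * of_int (fst v), t * of_int (snd v)) | t. True}"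

definition parallel :: "int \<times> int \<Rightarrow> int \<times> int \<Rightarrow> bool" where
  "parallel v w \<longleftrightarrow> (of_int (fst w), of_int (snd w)) \<in> rat_span v"

definition line_polynomial :: "int \<times> int \<Rightarrow> laurent2 \<Rightarrow> bool" where
  "line_polynomial v p \<longleftrightarrow> v \<noteq> 0 \<and> card (Poly_Mapping.keys p) \<ge> 2 \<and>
     (\<exists>u. \<forall>z \<in> Poly_Mapping.keys p.
        (of_int (fst (z - u)), of_int (snd (z - u))) \<in> rat_span v)"

definition line_factors_at_most_one_direction :: "laurent2 \<Rightarrow> bool" where
  "line_factors_at_most_one_direction g \<longleftrightarrow>
     (\<forall>p q v w. p dvd g \<and> q dvd g \<and> line_polynomial v p \<and> line_polynomial w q
        \<longrightarrow> parallel v w)"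

definition covering :: "(int \<times> int) set \<Rightarrow> nat \<Rightarrow> nat \<Rightarrow> (int \<times> int \<Rightarrow> nat) \<Rightarrow> bool" where
  "covering D b a c \<longleftrightarrow> (\<forall>u. c u \<in> {0, 1}) \<and>
     (\<forall>u. (c u = 1 \<longrightarrow> card {z \<in> (+) u ` D. c z = 1} = b) \<and>
          (c u = 0 \<longrightarrow> card {z \<in> (+) u ` D. c z = 1} = a))"

text \<open>Algorithms are partial recursive functions. Arities are left implicit: a term denotes a
  partial function on argument lists of every length, undefined where too few arguments are
  supplied and otherwise ignoring superfluous ones. \<open>Prim\<close> recurses on, and \<open>Mu\<close> minimises
  over, the first argument; \<open>Mu\<close> diverges if the term under it is undefined before its first
  zero.\<close>

datatype recfun =
    Zero
  | Succ
  | Proj nat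
  | Comp recfun "recfun list"
  | Prim recfun recfun
  | Mu recfun

definition mu_search :: "(nat \<Rightarrow> nat option) \<Rightarrow> nat option" where
  "mu_search h =
     (if \<exists>n. h n = Some 0 \<and> (\<forall>m<n. \<exists>k. h m = Some (Suc k))
      then Some (LEAST n. h n = Some 0) else None)"

primrec run :: "recfun \<Rightarrow> nat list \<Rightarrow> nat option" where
  "run Zero xs = Some 0"
| "run Succ xs = (case xs of [] \<Rightarrow> None | x # _ \<Rightarrow> Some (Suc x))"
| "run (Proj i) xs = (if i < length xs then Some (xs ! i) else None)"
| "run (Comp f gs) xs = Option.bind (those (map (\<lambda>g. run g xs) gs)) (run f)"
| "run (Prim f g) xs = (case xs of [] \<Rightarrow> None
     | n # ys \<Rightarrow> rec_nat (run f ys) (\<lambda>k r. Option.bind r (\<lambda>y. run g (k # y # ys))) n)"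
| "run (Mu f) xs = mu_search (\<lambda>n. run f (n # xs))"

definition int_pair_encode :: "int \<times> int \<Rightarrow> nat" where
  "int_pair_encode u = prod_encode (int_encode (fst u), int_encode (snd u))"

text \<open>A finite set of integer pairs is presented to an algorithm as the number whose binary
  digits are the indicator sequence of the set under the pairing bijection.\<close>

definition shape_encode :: "(int \<times> int) set \<Rightarrow> nat" where
  "shape_encode D = set_encode (int_pair_encode ` D)"

end

theory Submission
  imports Defs "HOL-Library.FuncSet" "HOL-Library.Infinite_Set"
    "HOL-Computational_Algebra.Primes"
begin

text \<open>Non-existence of a covering is semi-decidable by compactness, so it suffices that an existing
  covering under the hypothesis can be replaced by a doubly periodic one, which is a finite
  certificate. Let \<open>w\<close> be the only possible direction of line polynomial factors of \<open>g\<close>. The bounded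
  integer configuration \<open>e = (X\<^sup>w - 1) c\<close> is annihilated by \<open>g\<close>, hence, by reduction modulo large
  primes, by a product of binomials \<open>X\<^sup>v - 1\<close>. If \<open>v\<close> is not parallel to \<open>w\<close>, then no \<open>X\<^sup>u - \<zeta>\<close> with
  \<open>u\<close> parallel to \<open>v\<close> divides \<open>g\<close>, so a configuration of period \<open>v\<close> annihilated by \<open>g\<close> is doubly
  periodic and the factor may be exchanged for \<open>X\<^bsup>mw\<^esup> - 1\<close>. In the end a power of some \<open>X\<^bsup>mw\<^esup> - 1\<close>
  annihilates \<open>c\<close>, and boundedness reduces the power to one. A covering of period \<open>mw\<close> yields a
  doubly periodic one by the pigeonhole principle.\<close>

section \<open>Configurations as a module over the Laurent polynomials\<close>

text \<open>A covering satisfies g c = a with the constant a on the right, not 0. One difference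
  removes the constant, and taking it along w is harmless because factors in direction w are kept
  anyway. Two coefficient rings are involved. Reduction modulo primes needs an annihilator with
  integer coefficients and integer values. The hypothesis speaks of complex factors, which enter
  through roots of unity: a configuration of period n v splits into eigenconfigurations of the
  translation by v, and on one of them g can degenerate to the zero recurrence only if a binomial
  X^v - const divides g. So the same annihilator is used once over the integers and once over the
  complex numbers. The hypothesis on factors secures that the search for certificates ends; the
  correctness of the answer comes from the certificates themselves.\<close>

lemma sum_single_keys: "(\<Sum>u\<in>Poly_Mapping.keys p. Poly_Mapping.single u (Poly_Mapping.lookup p u)) = p"
  by (rule poly_mapping_eqI)
    (simp add: lookup_sum lookup_single when_def in_keys_iff)

text \<open>The monomial X^u acts as translation by u, and the negated exponents of f_D make its
  action sum over z + D. The coefficient ring is a parameter because both integers and complex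
  numbers are used.\<close>

definition act :: "((int \<times> int) \<Rightarrow>\<^sub>0 'a::comm_ring_1) \<Rightarrow> (int \<times> int \<Rightarrow> 'a) \<Rightarrow> int \<times> int \<Rightarrow> 'a" where
  "act p e z = (\<Sum>u\<in>Poly_Mapping.keys p. Poly_Mapping.lookup p u * e (z - u))"

lemma act_superset:
  assumes "finite S" "Poly_Mapping.keys p \<subseteq> S"
  shows "act p e z = (\<Sum>u\<in>S. Poly_Mapping.lookup p u * e (z - u))"
  unfolding act_def by (rule sum.mono_neutral_left) (use assms in \<open>auto simp: in_keys_iff\<close>)

lemma act_add: "act (p + q) e z = act p e z + act q e z"
  using act_superset[of "Poly_Mapping.keys p \<union> Poly_Mapping.keys q" "p + q" e z]
    act_superset[of "Poly_Mapping.keys p \<union> Poly_Mapping.keys q" p e z]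
    act_superset[of "Poly_Mapping.keys p \<union> Poly_Mapping.keys q" q e z] Poly_Mapping.keys_add[of p q]
  by (simp add: lookup_add algebra_simps sum.distrib)

lemma act_zero [simp]: "act 0 e z = 0"
  by (simp add: act_def)

lemma act_uminus: "act (- p) e z = - act p e z"
  using act_add[of p "- p" e z] by (simp add: eq_neg_iff_add_eq_0 add.commute)

lemma act_diff: "act (p - q) e z = act p e z - act q e z"
  using act_add[of p "- q" e z] by (simp add: act_uminus)

lemma act_sum: "act (\<Sum>i\<in>I. p i) e z = (\<Sum>i\<in>I. act (p i) e z)"
  by (induction I rule: infinite_finite_induct) (auto simp: act_add)

lemma act_single [simp]: "act (Poly_Mapping.single u k) e z = k * e (z - u)"
  by (cases "k = 0") (auto simp: act_def)

lemma act_one [simp]: "act 1 e z = e z"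
  by (simp del: single_one add: single_one[symmetric])

lemma act_of_nat [simp]: "act (of_nat n) e z = of_nat n * e z"
  by (induction n) (auto simp: act_add algebra_simps)

lemma act_mult: "act (p * q) e z = act p (act q e) z"
proof -
  let ?p = "Poly_Mapping.lookup p" and ?q = "Poly_Mapping.lookup q"
  have "p * q = (\<Sum>u\<in>Poly_Mapping.keys p. \<Sum>v\<in>Poly_Mapping.keys q.
      Poly_Mapping.single (u + v) (?p u * ?q v))"
    using sum_product[of "\<lambda>u. Poly_Mapping.single u (?p u)" "Poly_Mapping.keys p"
        "\<lambda>u. Poly_Mapping.single u (?q u)" "Poly_Mapping.keys q"]
    by (simp add: sum_single_keys mult_single)
  then have "act (p * q) e z = (\<Sum>u\<in>Poly_Mapping.keys p. \<Sum>v\<in>Poly_Mapping.keys q.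
      ?p u * ?q v * e (z - (u + v)))"
    by (simp add: act_sum)
  also have "\<dots> = act p (act q e) z"
    unfolding act_def by (simp add: sum_distrib_left mult.assoc diff_diff_eq)
  finally show ?thesis .
qed

lemma act_config_zero [simp]: "act p (\<lambda>_. 0) z = 0"
  by (simp add: act_def)

section \<open>Lattice vectors and difference operators\<close>

definition smul :: "int \<Rightarrow> int \<times> int \<Rightarrow> int \<times> int" where
  "smul k u = (k * fst u, k * snd u)"

text \<open>For fixed v, \<open>det2 v z\<close> is constant on lines in direction v, so it measures
  the position across v; between non-zero vectors it vanishes exactly when they are
  parallel.\<close>

definition det2 :: "int \<times> int \<Rightarrow> int \<times> int \<Rightarrow> int" where
  "det2 u v = fst u * snd v - snd u * fst v"

lemma smul_simps [simp]: "smul 0 u = 0" "smul 1 u = u" "smul k 0 = 0" "smul (-1) u = - u"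
  by (auto simp: smul_def prod_eq_iff)

lemma smul_algebra:
  "smul (k + l) u = smul k u + smul l u" "smul (k - l) u = smul k u - smul l u"
  "smul k (u + v) = smul k u + smul k v" "smul k (u - v) = smul k u - smul k v"
  "smul (- k) u = - smul k u"
  by (auto simp: smul_def prod_eq_iff algebra_simps)

lemma smul_smul: "smul k (smul l u) = smul (k * l) u"
  by (auto simp: smul_def)

lemma smul_eq_0_iff [simp]: "smul k u = 0 \<longleftrightarrow> k = 0 \<or> u = 0"
  by (auto simp: smul_def prod_eq_iff)

text \<open>The operator X^(-v) - 1, a unit multiple of X^v - 1. With this sign its vanishing says
  that v is a period.\<close>

definition diff :: "int \<times> int \<Rightarrow> (int \<times> int \<Rightarrow> 'a::comm_ring_1) \<Rightarrow> int \<times> int \<Rightarrow> 'a" where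
  "diff v e z = e (z + v) - e z"

lemma diff_eq_act: "diff v e = act (Poly_Mapping.single (- v) 1 - 1) e"
  by (rule ext) (simp add: diff_def act_diff)

lemma act_diff_commute: "act p (diff v e) = diff v (act p e)"
  unfolding diff_eq_act by (metis act_mult mult.commute ext)

lemma diff_commute: "diff v (diff w e) = diff w (diff v e)"
  unfolding diff_eq_act by (metis act_mult mult.commute ext)

lemma diff_eq_0_iff: "diff v e = (\<lambda>_. 0) \<longleftrightarrow> (\<forall>z. e (z + v) = e z)"
  by (auto simp: diff_def fun_eq_iff)

lemma period_smul:
  assumes "\<And>z. e (z + v) = e z"
  shows "e (z + smul k v) = e z"
proof (induction k rule: int_induct[where k = 0])
  case (step1 i)
  then show ?case using assms[of "z + smul i v"] by (simp add: smul_algebra add.assoc)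
next
  case (step2 i)
  then show ?case using assms[of "z + smul (i - 1) v"] by (simp add: smul_algebra)
qed simp

section \<open>Annihilation by difference operators\<close>

text \<open>The inner binomial coefficients are divisible by p. Phrasing the Frobenius congruence as
  divisibility lets it apply to Laurent polynomials without a quotient ring.\<close>

lemma of_nat_prime_dvd_power_add:
  fixes a b :: "'a::comm_ring_1"
  assumes "prime p"
  shows "of_nat p dvd (a + b) ^ p - (a ^ p + b ^ p)"
proof -
  have p: "p > 0" using assms prime_gt_0_nat by blast
  have "(a + b) ^ p = (\<Sum>k\<le>p. of_nat (p choose k) * a ^ k * b ^ (p - k))"
    by (rule binomial_ring)
  also have "{..p} = insert 0 (insert p {1..<p})" using p by auto
  also have "(\<Sum>k\<in>\<dots>. of_nat (p choose k) * a ^ k * b ^ (p - k)) =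
      a ^ p + b ^ p + (\<Sum>k\<in>{1..<p}. of_nat (p choose k) * a ^ k * b ^ (p - k))"
    using p by simp
  finally have "(a + b) ^ p - (a ^ p + b ^ p) =
      (\<Sum>k\<in>{1..<p}. of_nat (p choose k) * a ^ k * b ^ (p - k))" by simp
  also have "of_nat p dvd \<dots>"
  proof (rule dvd_sum)
    fix k assume k: "k \<in> {1..<p}"
    have "p dvd p choose k" using k assms by (intro dvd_choose_prime) auto
    then have "(of_nat p :: 'a) dvd of_nat (p choose k)" by (metis dvd_def of_nat_mult)
    then show "of_nat p dvd of_nat (p choose k) * a ^ k * b ^ (p - k)"
      by (simp add: mult.assoc)
  qed
  finally show ?thesis .
qed

lemma of_nat_prime_dvd_power_sum:
  fixes f :: "'b \<Rightarrow> 'a::comm_ring_1"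
  assumes "prime p"
  shows "of_nat p dvd (\<Sum>i\<in>I. f i) ^ p - (\<Sum>i\<in>I. f i ^ p)"
proof (induction I rule: infinite_finite_induct)
  case (insert x F)
  have "of_nat p dvd (f x + sum f F) ^ p - (f x ^ p + sum f F ^ p)"
    by (rule of_nat_prime_dvd_power_add[OF assms])
  from dvd_add[OF this insert.IH] show ?case
    using insert.hyps by (simp add: algebra_simps)
qed (use assms prime_gt_0_nat in \<open>auto simp: power_0_left\<close>)

text \<open>Fermat's little theorem, from the Frobenius congruence by induction in both directions
  from 0.\<close>

lemma prime_dvd_power_minus_int:
  assumes "prime p"
  shows "int p dvd k ^ p - k"
proof (induction k rule: int_induct[where k = 0])
  case base
  then show ?case using assms prime_gt_0_nat by (auto simp: power_0_left)
next
  case (step1 i)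
  have "int p dvd (i + 1) ^ p - (i ^ p + 1)"
    using of_nat_prime_dvd_power_add[OF assms, of i 1] by simp
  from dvd_add[OF this step1(2)] show ?case by (simp add: algebra_simps)
next
  case (step2 i)
  have "int p dvd i ^ p - ((i - 1) ^ p + 1)"
    using of_nat_prime_dvd_power_add[OF assms, of "i - 1" 1] by simp
  from dvd_diff[OF step2(2) this] show ?case by (simp add: algebra_simps)
qed

lemma single_power: "Poly_Mapping.single u k ^ n = Poly_Mapping.single (smul (int n) u) (k ^ n)"
  by (induction n) (auto simp: mult_single smul_algebra zero_prod_def[symmetric] add.commute)

text \<open>The substitution g(x^m, y^m).\<close>

definition dilate :: "nat \<Rightarrow> ((int \<times> int) \<Rightarrow>\<^sub>0 int) \<Rightarrow> ((int \<times> int) \<Rightarrow>\<^sub>0 int)" where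
  "dilate m g = (\<Sum>u\<in>Poly_Mapping.keys g. Poly_Mapping.single (smul (int m) u) (Poly_Mapping.lookup g u))"

text \<open>Frobenius reduces the power to p-th powers of the terms, and Fermat restores their
  integer coefficients.\<close>

lemma dilate_prime_mult:
  assumes "prime p"
  shows "of_nat p dvd dilate m g ^ p - dilate (p * m) g"
proof -
  let ?f = "\<lambda>u. Poly_Mapping.single (smul (int m) u) (Poly_Mapping.lookup g u)"
  have "of_nat p dvd (\<Sum>u\<in>Poly_Mapping.keys g. ?f u ^ p) - dilate (p * m) g"
    unfolding dilate_def sum_subtractf[symmetric]
  proof (rule dvd_sum)
    fix u
    let ?k = "Poly_Mapping.lookup g u" and ?v = "smul (int (p * m)) u"
    obtain l where l: "?k ^ p - ?k = int p * l"
      using prime_dvd_power_minus_int[OF assms] by blast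
    have "?f u ^ p - Poly_Mapping.single ?v ?k = Poly_Mapping.single ?v (?k ^ p - ?k)"
      by (simp add: single_power smul_smul single_diff)
    also have "\<dots> = of_nat p * Poly_Mapping.single ?v l"
      unfolding l by (simp add: mult_single flip: single_of_nat)
    finally show "of_nat p dvd ?f u ^ p - Poly_Mapping.single ?v ?k" by simp
  qed
  moreover have "of_nat p dvd dilate m g ^ p - (\<Sum>u\<in>Poly_Mapping.keys g. ?f u ^ p)"
    unfolding dilate_def by (rule of_nat_prime_dvd_power_sum[OF assms])
  ultimately show ?thesis using dvd_add by fastforce
qed

lemma act_dilate: "act (dilate m g) e z =
    (\<Sum>u\<in>Poly_Mapping.keys g. Poly_Mapping.lookup g u * e (z - smul (int m) u))"
  by (simp add: dilate_def act_sum)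

text \<open>Modulo a prime \<open>p\<close>, raising \<open>g\<close> to the power \<open>p\<close> dilates it by \<open>p\<close>; for a large prime
  the values of the dilated annihilator are too small to vanish modulo \<open>p\<close> without being zero.\<close>

lemma act_dilate_eq_0:
  fixes e :: "int \<times> int \<Rightarrow> int"
  assumes bounded: "\<And>z. \<bar>e z\<bar> \<le> B" and ann: "act g e = (\<lambda>_. 0)"
    and M: "M = B * (\<Sum>u\<in>Poly_Mapping.keys g. \<bar>Poly_Mapping.lookup g u\<bar>)"
    and m: "m > 0" "\<And>p. prime p \<Longrightarrow> p dvd m \<Longrightarrow> M < int p"
  shows "act (dilate m g) e z = 0"
  using m
proof (induction m arbitrary: z rule: prime_divisors_induct)
  case (unit m)
  then have "dilate m g = g" by (simp add: dilate_def sum_single_keys)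
  then show ?case using ann by simp
next
  case (factor p m)
  have p: "p > 0" using factor prime_gt_0_nat by blast
  obtain q where q: "dilate m g ^ p - dilate (p * m) g = of_nat p * q"
    using dilate_prime_mult[OF factor(1)] by blast
  have "act (dilate m g) e = (\<lambda>_. 0)" using factor by (auto simp: fun_eq_iff)
  \<comment> \<open>The p-th power still contains the factor \<open>dilate m g\<close>, which
    annihilates e by induction.\<close>
  then have "act (dilate m g ^ (p - 1) * dilate m g) e z = 0" by (simp add: act_mult)
  then have "act (dilate m g ^ p) e z = 0" using power_minus_mult[OF p] by metis
  then have "- act (dilate (p * m) g) e z = int p * act q e z"
    using q by (metis act_diff act_mult act_of_nat diff_0)
  then have dvd: "int p dvd act (dilate (p * m) g) e z"
    by (metis dvd_minus_iff dvd_triv_left)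
  \<comment> \<open>Dilation moves the exponents but keeps the coefficients, so one bound
    \<open>M\<close> serves every prime factor of m.\<close>
  have "\<bar>act (dilate (p * m) g) e z\<bar> \<le> (\<Sum>u\<in>Poly_Mapping.keys g.
      \<bar>Poly_Mapping.lookup g u * e (z - smul (int (p * m)) u)\<bar>)"
    unfolding act_dilate by (rule sum_abs)
  also have "\<dots> \<le> (\<Sum>u\<in>Poly_Mapping.keys g. \<bar>Poly_Mapping.lookup g u\<bar> * B)"
    by (rule sum_mono) (auto simp: abs_mult intro!: mult_left_mono bounded)
  also have "\<dots> = M" by (simp add: M sum_distrib_left mult.commute)
  also have "\<dots> < int p" using factor by auto
  finally show ?case using dvd by (metis abs_of_nat dvd_imp_le_int leD)
qed simp

text \<open>The dilates of \<open>g\<close> by \<open>1 + k r\<close> are power sums \<open>\<Sum>u. g\<^sub>u X\<^sup>u T\<^sub>u\<^sup>k\<close> with \<open>T\<^sub>u = X\<^bsup>ru\<^esup>\<close>, so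
  all terms but one can be eliminated as for a Vandermonde system.\<close>

lemma ex_difference_annihilator:
  fixes e :: "int \<times> int \<Rightarrow> int"
  assumes bounded: "\<And>z. \<bar>e z\<bar> \<le> B" and ann: "act g e = (\<lambda>_. 0)" and "g \<noteq> 0"
  obtains vs where "0 \<notin> set vs" "foldr diff vs e = (\<lambda>_. 0)"
proof -
  define S where "S = Poly_Mapping.keys g"
  \<comment> \<open>Every prime up to the bound divides r, so none divides 1 + k r and all these
    dilations are admissible.\<close>
  define r where "r = (fact (nat (B * (\<Sum>u\<in>S. \<bar>Poly_Mapping.lookup g u\<bar>))) :: nat)"
  define a where "a u = Poly_Mapping.single u (Poly_Mapping.lookup g u)" for u
  define T :: "int \<times> int \<Rightarrow> (int \<times> int) \<Rightarrow>\<^sub>0 int" where "T u = Poly_Mapping.single (smul (int r) u) 1" for u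
  have fin: "finite S" by (simp add: S_def)
  have r: "r > 0" by (simp add: r_def)
  obtain u0 where u0: "u0 \<in> S"
    using \<open>g \<noteq> 0\<close> unfolding S_def by (metis keys_eq_empty equals0I)
  have dil: "act (dilate (1 + k * r) g) e z = 0" for k z
  proof (rule act_dilate_eq_0[OF bounded ann refl])
    fix p :: nat assume p: "prime p" "p dvd 1 + k * r"
    show "B * (\<Sum>u\<in>Poly_Mapping.keys g. \<bar>Poly_Mapping.lookup g u\<bar>) < int p"
    proof (rule ccontr)
      assume "\<not> ?thesis"
      then have "p \<le> nat (B * (\<Sum>u\<in>S. \<bar>Poly_Mapping.lookup g u\<bar>))" by (simp add: S_def)
      then have "p dvd r" unfolding r_def using p(1) prime_ge_1_nat by (intro dvd_fact) auto
      then show False using p by (metis dvd_add_left_iff dvd_mult not_prime_unit)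
    qed
  qed simp
  \<comment> \<open>Subtracting \<open>T w\<close> times the sum for k from the sum for k + 1
    multiplies the term of u by \<open>T u - T w\<close>, which removes u = w. This is why k stays
    universally quantified.\<close>
  have elim: "act (\<Sum>u\<in>S. a u * T u ^ k * (\<Prod>v\<in>W. T u - T v)) e = (\<lambda>_. 0)" if "finite W" for W k
    using that
  proof (induction W arbitrary: k rule: finite_induct)
    case empty
    have "a u * T u ^ k = Poly_Mapping.single (smul (int (1 + k * r)) u) (Poly_Mapping.lookup g u)" for u
      by (simp add: a_def T_def single_power mult_single smul_smul smul_algebra)
    then have "(\<Sum>u\<in>S. a u * T u ^ k * (\<Prod>v\<in>{}. T u - T v)) = dilate (1 + k * r) g"
      by (simp add: dilate_def S_def)
    then show ?case using dil by presburger
  next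
    case (insert w W)
    have "a u * T u ^ k * (\<Prod>v\<in>insert w W. T u - T v) =
      a u * T u ^ Suc k * (\<Prod>v\<in>W. T u - T v) - T w * (a u * T u ^ k * (\<Prod>v\<in>W. T u - T v))" for u
      using insert.hyps by (simp add: algebra_simps)
    then have eq: "(\<Sum>u\<in>S. a u * T u ^ k * (\<Prod>v\<in>insert w W. T u - T v)) =
      (\<Sum>u\<in>S. a u * T u ^ Suc k * (\<Prod>v\<in>W. T u - T v)) -
      T w * (\<Sum>u\<in>S. a u * T u ^ k * (\<Prod>v\<in>W. T u - T v))"
      by (simp only: sum_subtractf sum_distrib_left)
    show ?case
      unfolding eq by (rule ext) (simp only: act_diff act_mult insert.IH act_config_zero)
  qed
  let ?Q = "\<Prod>v\<in>S - {u0}. T u0 - T v"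
  have "(\<Sum>u\<in>S. a u * T u ^ 0 * (\<Prod>v\<in>S - {u0}. T u - T v)) =
      (\<Sum>u\<in>S. if u = u0 then a u0 * ?Q else 0)"
  proof (rule sum.cong)
    fix u assume "u \<in> S"
    show "a u * T u ^ 0 * (\<Prod>v\<in>S - {u0}. T u - T v) = (if u = u0 then a u0 * ?Q else 0)"
    proof (cases "u = u0")
      case False
      then have "(\<Prod>v\<in>S - {u0}. T u - T v) = 0"
        using fin \<open>u \<in> S\<close> by (intro prod_zero) auto
      then show ?thesis using False by simp
    qed simp
  qed simp
  then have "act (a u0 * ?Q) e = (\<lambda>_. 0)"
    using elim[of "S - {u0}" 0] fin u0 by simp
  \<comment> \<open>The surviving \<open>a u0\<close> is a monomial: a translation and a non-zero
    integer, both of which cancel.\<close>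
  then have "Poly_Mapping.lookup g u0 * act ?Q e (z - u0) = 0" for z
    by (metis a_def act_mult act_single)
  then have "act ?Q e z = 0" for z
    using u0 unfolding S_def in_keys_iff by (metis add_diff_cancel_right' mult_eq_0_iff)
  then have Q: "act ?Q e = (\<lambda>_. 0)" by blast
  \<comment> \<open>\<open>T u0 - T w\<close> is the difference in direction r (u0 - w) up to sign
    and translation; both pass through the remaining differences.\<close>
  have shift: "foldr diff vs (\<lambda>z. - f (z - t)) z = - foldr diff vs f (z - t)"
    for vs t z and f :: "int \<times> int \<Rightarrow> int"
    by (induction vs arbitrary: z) (auto simp: diff_def algebra_simps)
  have "\<exists>vs. 0 \<notin> set vs \<and> foldr diff vs e = (\<lambda>_. 0)"
    if "finite W" "u0 \<notin> W" "act (\<Prod>v\<in>W. T u0 - T v) e = (\<lambda>_. 0)" for W and e :: "int \<times> int \<Rightarrow> int"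
    using that
  proof (induction W arbitrary: e rule: finite_induct)
    case empty
    then show ?case by (intro exI[of _ "[]"]) (auto simp: fun_eq_iff)
  next
    case (insert w W)
    let ?d = "smul (int r) (u0 - w)"
    have "act (T u0 - T w) e = (\<lambda>z. - diff ?d e (z - smul (int r) u0))"
      by (rule ext) (simp add: T_def act_diff diff_def smul_algebra algebra_simps)
    moreover have "act (\<Prod>v\<in>W. T u0 - T v) (act (T u0 - T w) e) = (\<lambda>_. 0)"
      using insert by (simp add: act_mult[symmetric] mult.commute fun_eq_iff)
    ultimately obtain vs where vs: "0 \<notin> set vs"
      "foldr diff vs (\<lambda>z. - diff ?d e (z - smul (int r) u0)) = (\<lambda>_. 0)"
      using insert.IH insert.prems by force
    have "foldr diff vs (diff ?d e) z = 0" for z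
      using fun_cong[OF vs(2), of "z + smul (int r) u0"] unfolding shift by simp
    then show ?case
      using vs insert.prems r by (intro exI[of _ "vs @ [?d]"]) auto
  qed
  from this[OF _ _ Q] show ?thesis using fin that by auto
qed

section \<open>Configurations that are periodic in some direction\<close>

text \<open>The recurrence at t + a isolates d t, because a is the least shift and has a non-zero
  coefficient; the other values lie among the b - a preceding ones.\<close>

lemma recurrence_zero_forward:
  fixes d :: "int \<Rightarrow> 'a::field"
  assumes "finite J" "a \<in> J" "\<And>j. j \<in> J \<Longrightarrow> a \<le> j" "\<And>j. j \<in> J \<Longrightarrow> j \<le> b" "\<gamma> a \<noteq> 0"
    and rec: "\<And>t. (\<Sum>j\<in>J. \<gamma> j * d (t - j)) = 0"
    and zero: "\<And>t. s \<le> t \<Longrightarrow> t < s + (b - a) \<Longrightarrow> d t = 0"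
    and "s \<le> t"
  shows "d t = 0"
  using \<open>s \<le> t\<close>
proof (induction "nat (t - s)" arbitrary: t rule: less_induct)
  case less
  show ?case
  proof (cases "t < s + (b - a)")
    case False
    have "d (t + a - j) = 0" if "j \<in> J - {a}" for j
    proof (rule less.hyps)
      have "a \<le> j" "j \<noteq> a" "j \<le> b" using that assms(3,4) by auto
      then show "nat (t + a - j - s) < nat (t - s)" "s \<le> t + a - j" using False less.prems by auto
    qed
    then have "(\<Sum>j\<in>J - {a}. \<gamma> j * d (t + a - j)) = 0" by simp
    then show ?thesis
      using rec[of "t + a"] assms(1,2,5) by (simp add: sum.remove)
  qed (use zero less.prems in auto)
qed

text \<open>For times before the window, the reversed sequence obeys the reversed recurrence, whose
  least shift is -b.\<close>

lemma recurrence_zero: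
  fixes d :: "int \<Rightarrow> 'a::field"
  assumes fin: "finite J" and ab: "a \<in> J" "b \<in> J" "\<And>j. j \<in> J \<Longrightarrow> a \<le> j \<and> j \<le> b"
    and ne: "\<gamma> a \<noteq> 0" "\<gamma> b \<noteq> 0"
    and rec: "\<And>t. (\<Sum>j\<in>J. \<gamma> j * d (t - j)) = 0"
    and zero: "\<And>t. s \<le> t \<Longrightarrow> t < s + (b - a) \<Longrightarrow> d t = 0"
  shows "d t = 0"
proof (cases "s \<le> t")
  case True
  then show ?thesis
    using recurrence_zero_forward[OF fin ab(1), of b \<gamma> d s t] assms by blast
next
  case False
  define r where "r t = d (- t)" for t
  have rec': "(\<Sum>j\<in>uminus ` J. \<gamma> (- j) * r (t - j)) = 0" for t
  proof -
    have "(\<Sum>j\<in>uminus ` J. \<gamma> (- j) * r (t - j)) = (\<Sum>j\<in>J. \<gamma> j * r (t + j))"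
      by (subst sum.reindex) auto
    also have "\<dots> = 0" using rec[of "- t"] by (simp add: r_def)
    finally show ?thesis .
  qed
  \<comment> \<open>Negation maps the window from s to s + (b - a) - 1 onto the one starting at 1 -
    s - (b - a).\<close>
  have "r (- t) = 0"
  proof (rule recurrence_zero_forward[where J = "uminus ` J" and a = "- b" and b = "- a"
        and \<gamma> = "\<lambda>j. \<gamma> (- j)" and s = "1 - s - (b - a)" and d = r])
    fix u assume "1 - s - (b - a) \<le> u" "u < 1 - s - (b - a) + (- a - - b)"
    then show "r u = 0" unfolding r_def by (intro zero) auto
  next
    have "a \<le> b" using ab by auto
    then show "1 - s - (b - a) \<le> - t" using False by linarith
  qed (use assms rec' in auto)
  then show ?thesis by (simp add: r_def)
qed

text \<open>Windows of length b - a take finitely many values, so two coincide. The difference of f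
  and its translate by their distance vanishes on a window, hence everywhere.\<close>

lemma recurrence_periodic:
  fixes f :: "int \<Rightarrow> 'a::field"
  assumes "finite (range f)" "finite J" "\<exists>j\<in>J. \<gamma> j \<noteq> 0"
    and rec: "\<And>t. (\<Sum>j\<in>J. \<gamma> j * f (t - j)) = 0"
  shows "\<exists>h>0. \<forall>t. f (t + int h) = f t"
proof -
  define I where "I = {j \<in> J. \<gamma> j \<noteq> 0}"
  have I: "finite I" "I \<noteq> {}" using assms by (auto simp: I_def)
  define a b where "a = Min I" and "b = Max I"
  have recI: "(\<Sum>j\<in>I. \<gamma> j * f (t - j)) = 0" for t
  proof -
    have "(\<Sum>j\<in>I. \<gamma> j * f (t - j)) = (\<Sum>j\<in>J. \<gamma> j * f (t - j))"
      unfolding I_def by (rule sum.mono_neutral_left) (use assms in auto)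
    then show ?thesis using rec by simp
  qed
  define win where "win n = (\<lambda>i\<in>{0..<b - a}. f (int n + i))" for n :: nat
  have "finite (win ` UNIV)"
    by (rule finite_subset[of _ "{0..<b - a} \<rightarrow>\<^sub>E range f"])
      (use assms(1) in \<open>auto simp: win_def intro!: finite_PiE\<close>)
  then obtain n0 where n0: "infinite {n. win n = win n0}"
    using pigeonhole_infinite[of "UNIV :: nat set" win] by auto
  then obtain n1 where n1: "n1 > n0" "win n1 = win n0"
    unfolding infinite_nat_iff_unbounded by auto
  define h where "h = n1 - n0"
  have "f (t + int h) - f t = 0" for t
  proof (rule recurrence_zero[where J = I and a = a and b = b and \<gamma> = \<gamma> and s = "int n0"
        and d = "\<lambda>t. f (t + int h) - f t"])
    fix t
    have "(\<Sum>j\<in>I. \<gamma> j * (f (t - j + int h) - f (t - j))) =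
      (\<Sum>j\<in>I. \<gamma> j * f (t + int h - j)) - (\<Sum>j\<in>I. \<gamma> j * f (t - j))"
      by (simp add: sum_subtractf[symmetric] right_diff_distrib algebra_simps)
    then show "(\<Sum>j\<in>I. \<gamma> j * (f (t - j + int h) - f (t - j))) = 0" by (simp add: recI)
  next
    fix t assume t: "int n0 \<le> t" "t < int n0 + (b - a)"
    have "win n1 (t - int n0) = win n0 (t - int n0)" using n1 by simp
    then show "f (t + int h) - f t = 0"
      using t n1 by (simp add: win_def h_def of_nat_diff algebra_simps)
  qed (use I Min_in[OF I] Max_in[OF I] in \<open>auto simp: a_def b_def I_def\<close>)
  then show ?thesis using n1 by (intro exI[of _ h]) (auto simp: h_def)
qed

section \<open>Eigenconfigurations in unimodular coordinates\<close>

lemma unimodular_coordinates: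
  assumes "det2 v u = 1"
  shows "x = smul (det2 x u) v + smul (det2 v x) u"
proof -
  have "fst x = fst x * det2 v u" "snd x = snd x * det2 v u" using assms by auto
  then show ?thesis
    unfolding prod_eq_iff by (simp add: smul_def det2_def algebra_simps)
qed

text \<open>Modulo the binomial X^v equals \<eta>. Both are units, so negative powers are covered
  too.\<close>

lemma binomial_dvd:
  fixes \<eta> :: "'a::field"
  assumes "\<eta> \<noteq> 0"
  shows "Poly_Mapping.single v 1 - Poly_Mapping.single 0 \<eta> dvd
    Poly_Mapping.single (smul i v) 1 - Poly_Mapping.single 0 (\<eta> powi i)"
    (is "?b dvd ?M i")
proof (induction i rule: int_induct[where k = 0])
  case (step1 i)
  have "?M (i + 1) = Poly_Mapping.single v 1 * ?M i + Poly_Mapping.single 0 (\<eta> powi i) * ?b"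
    using assms by (simp add: algebra_simps mult_single smul_algebra power_int_add)
  then show ?case using step1 by simp
next
  case (step2 i)
  have "?M (i - 1) = Poly_Mapping.single (- v) 1 * ?M i
      - Poly_Mapping.single (- v) (\<eta> powi (i - 1)) * ?b"
    using assms by (simp add: algebra_simps mult_single smul_algebra power_int_diff)
  then show ?case using step2 by simp
qed simp

lemma eigenconfig_smul:
  fixes e :: "int \<times> int \<Rightarrow> complex"
  assumes "\<And>z. e (z + v) = \<zeta> * e z" "\<zeta> \<noteq> 0"
  shows "e (z + smul i v) = \<zeta> powi i * e z"
proof (induction i rule: int_induct[where k = 0])
  case (step1 i)
  then show ?case
    using assms(1)[of "z + smul i v"] assms(2) by (simp add: smul_algebra add.assoc power_int_add)
next
  case (step2 i)
  then show ?case
    using assms(1)[of "z + smul (i - 1) v"] assms(2)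
    by (simp add: smul_algebra power_int_diff field_simps)
qed simp

text \<open>Since X^v acts as the inverse of \<zeta>, the equation g e = 0 becomes a linear
  recurrence along u with coefficients \<gamma>. It is trivial only if X^v minus that inverse
  divides g; otherwise the finite range of e yields a period.\<close>

lemma eigenconfig_periodic:
  fixes e :: "int \<times> int \<Rightarrow> complex"
  assumes uni: "det2 v u = 1" and eig: "\<And>z. e (z + v) = \<zeta> * e z" and "\<zeta> \<noteq> 0"
    and fin: "finite (range e)" and ann: "act g e = (\<lambda>_. 0)"
    and ndvd: "\<not> Poly_Mapping.single v 1 - Poly_Mapping.single 0 (inverse \<zeta>) dvd g"
  shows "\<exists>h>0. \<forall>z. e (z + smul (int h) u) = e z"
proof -
  define J where "J = det2 v ` Poly_Mapping.keys g"
  define \<gamma> where "\<gamma> j = (\<Sum>x | x \<in> Poly_Mapping.keys g \<and> det2 v x = j.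
    Poly_Mapping.lookup g x * inverse \<zeta> powi det2 x u)" for j
  define f where "f t = e (smul t u)" for t
  have finJ: "finite J" by (simp add: J_def)
  have group: "(\<Sum>x\<in>Poly_Mapping.keys g. F x) =
      (\<Sum>j\<in>J. \<Sum>x | x \<in> Poly_Mapping.keys g \<and> det2 v x = j. F x)" for F :: "int \<times> int \<Rightarrow> 'b::comm_monoid_add"
    unfolding J_def by (rule sum.image_gen) simp
  have rec: "(\<Sum>j\<in>J. \<gamma> j * f (t - j)) = 0" for t
  proof -
    have e: "e (smul t u - x) = inverse \<zeta> powi det2 x u * f (t - det2 v x)" for x
    proof -
      have "smul t u - x = smul (t - det2 v x) u + smul (- det2 x u) v"
        by (subst unimodular_coordinates[OF uni, of x]) (simp add: smul_algebra)
      then show ?thesis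
        using eigenconfig_smul[of e v \<zeta>, OF eig \<open>\<zeta> \<noteq> 0\<close>, of "smul (t - det2 v x) u" "- det2 x u"]
        by (simp add: f_def power_int_minus power_int_inverse)
    qed
    have "0 = act g e (smul t u)" using ann by simp
    also have "\<dots> = (\<Sum>x\<in>Poly_Mapping.keys g.
        Poly_Mapping.lookup g x * inverse \<zeta> powi det2 x u * f (t - det2 v x))"
      by (simp add: act_def e mult.assoc)
    also have "\<dots> = (\<Sum>j\<in>J. \<gamma> j * f (t - j))"
      unfolding group \<gamma>_def by (simp add: sum_distrib_right)
    finally show ?thesis by simp
  qed
  have "\<exists>j\<in>J. \<gamma> j \<noteq> 0"
  proof (rule ccontr)
    assume "\<not> ?thesis"
    then have zero: "\<gamma> j = 0" if "j \<in> J" for j using that by blast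
    let ?b = "Poly_Mapping.single v 1 - Poly_Mapping.single 0 (inverse \<zeta>)"
    \<comment> \<open>\<open>?N x\<close> is the term of g at x with its v-component evaluated.
      Collected by lines, these terms have the coefficients \<gamma>, all zero here.\<close>
    let ?N = "\<lambda>x. Poly_Mapping.single (smul (det2 v x) u)
        (Poly_Mapping.lookup g x * inverse \<zeta> powi det2 x u)"
    have "?b dvd Poly_Mapping.single x (Poly_Mapping.lookup g x) - ?N x" for x
    proof -
      have "Poly_Mapping.single x (Poly_Mapping.lookup g x) - ?N x =
        Poly_Mapping.single (smul (det2 v x) u) (Poly_Mapping.lookup g x) *
        (Poly_Mapping.single (smul (det2 x u) v) 1 - Poly_Mapping.single 0 (inverse \<zeta> powi det2 x u))"
        using unimodular_coordinates[OF uni, of x]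
        by (simp add: right_diff_distrib mult_single add.commute)
      then show ?thesis
        using binomial_dvd[of "inverse \<zeta>" v "det2 x u"] \<open>\<zeta> \<noteq> 0\<close> by simp
    qed
    then have "?b dvd (\<Sum>x\<in>Poly_Mapping.keys g.
        Poly_Mapping.single x (Poly_Mapping.lookup g x) - ?N x)"
      by (rule dvd_sum)
    moreover have "(\<Sum>x\<in>Poly_Mapping.keys g. ?N x) =
        (\<Sum>j\<in>J. Poly_Mapping.single (smul j u) (\<gamma> j))"
    proof -
      have "(\<Sum>x\<in>Poly_Mapping.keys g. ?N x) = (\<Sum>j\<in>J. \<Sum>x | x \<in> Poly_Mapping.keys g \<and> det2 v x = j.
          Poly_Mapping.single (smul j u) (Poly_Mapping.lookup g x * inverse \<zeta> powi det2 x u))"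
        unfolding group by simp
      also have "\<dots> = (\<Sum>j\<in>J. Poly_Mapping.single (smul j u) (\<gamma> j))"
        unfolding \<gamma>_def
        by (intro sum.cong refl poly_mapping_eqI) (simp add: lookup_sum lookup_single when_def)
      finally show ?thesis .
    qed
    ultimately have "?b dvd g" by (simp add: sum_subtractf sum_single_keys zero)
    then show False using ndvd by simp
  qed
  moreover have "finite (range f)" using fin by (rule finite_subset[rotated]) (auto simp: f_def)
  ultimately obtain h where h: "h > 0" "\<And>t. f (t + int h) = f t"
    using recurrence_periodic[OF _ finJ _ rec] by blast
  have "e (z + smul (int h) u) = e z" for z
  proof -
    define i j where "i = det2 z u" and "j = det2 v z"
    have z: "z = smul j u + smul i v"
      using unimodular_coordinates[OF uni, of z] by (simp add: i_def j_def add.commute)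
    have "z + smul (int h) u = smul (j + int h) u + smul i v"
      unfolding z by (simp add: smul_algebra algebra_simps)
    then have "e (z + smul (int h) u) = \<zeta> powi i * f (j + int h)"
      using eigenconfig_smul[of e v \<zeta>, OF eig \<open>\<zeta> \<noteq> 0\<close>] by (simp add: f_def)
    also have "\<dots> = e z"
      unfolding h(2) using eigenconfig_smul[of e v \<zeta>, OF eig \<open>\<zeta> \<noteq> 0\<close>, of "smul j u" i]
      by (simp add: f_def flip: z)
    finally show ?thesis .
  qed
  then show ?thesis using h by blast
qed

text \<open>Orthogonality of the characters of the integers modulo n, used for Fourier inversion:
  for i other than 0 it is a full geometric sum of a root of unity different from 1.\<close>

lemma sum_powers_root_of_unity:
  assumes "i < n"
  shows "(\<Sum>k<n. inverse (cis (2 * pi / real n) ^ k) ^ i) = (if i = 0 then of_nat n else 0)"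
proof (cases "i = 0")
  case False
  define \<xi> where "\<xi> = inverse (cis (2 * pi / real n)) ^ i"
  have n: "n > 0" using assms by simp
  have root: "cis (2 * pi / real n) ^ i = cis (2 * pi * real i / real n)"
    by (simp add: DeMoivre mult_ac)
  have "cis (2 * pi * real i / real n) \<noteq> cis (2 * pi * real 0 / real n)"
    using bij_betw_imp_inj_on[OF bij_betw_roots_unity[OF n]] assms False n
    unfolding inj_on_def by blast
  moreover have "\<xi> = inverse (cis (2 * pi * real i / real n))"
    by (simp only: \<xi>_def root power_inverse)
  ultimately have "\<xi> \<noteq> 1" by (simp only: inverse_eq_1_iff) simp
  moreover have "\<xi> ^ n = inverse (cis (2 * pi / real n) ^ n) ^ i"
    by (simp only: \<xi>_def power_inverse power_mult[symmetric] mult.commute)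
  then have "\<xi> ^ n = 1" using n by (simp add: DeMoivre)
  ultimately have "(\<Sum>k<n. \<xi> ^ k) = 0" by (simp add: sum_gp_strict)
  moreover have "inverse (cis (2 * pi / real n) ^ k) ^ i = \<xi> ^ k" for k
    by (simp only: \<xi>_def power_inverse power_mult[symmetric] mult.commute)
  ultimately show ?thesis using False by simp
qed simp

text \<open>A configuration of period \<open>n v\<close> is the sum of its components in the eigenspaces of the
  translation by \<open>v\<close>, on each of which \<open>g\<close> acts as a nonzero polynomial in the translation by \<open>u\<close>.\<close>

lemma transverse_period:
  fixes e :: "int \<times> int \<Rightarrow> complex"
  assumes uni: "det2 v u = 1" and n: "n > 0" and per: "\<And>z. e (z + smul (int n) v) = e z"
    and fin: "finite (range e)" and ann: "act g e = (\<lambda>_. 0)"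
    and ndvd: "\<And>\<zeta>. \<zeta> \<noteq> 0 \<Longrightarrow> \<not> Poly_Mapping.single v 1 - Poly_Mapping.single 0 \<zeta> dvd g"
  shows "\<exists>h>0. \<forall>z. e (z + smul (int h) u) = e z"
proof -
  define \<zeta> where "\<zeta> k = cis (2 * pi / real n) ^ k" for k
  \<comment> \<open>n times the component of e on which translation by v has the eigenvalue
    \<open>\<zeta> k\<close>.\<close>
  define E where "E k z = (\<Sum>i<n. inverse (\<zeta> k) ^ i * e (z + smul (int i) v))" for k z
  have \<zeta>0: "\<zeta> k \<noteq> 0" for k by (simp add: \<zeta>_def)
  have \<zeta>n: "\<zeta> k ^ n = 1" for k
  proof -
    have "\<zeta> k ^ n = (cis (2 * pi / real n) ^ n) ^ k"
      unfolding \<zeta>_def by (simp add: mult.commute flip: power_mult)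
    then show ?thesis using n by (simp add: DeMoivre)
  qed
  have eig: "E k (z + v) = \<zeta> k * E k z" for k z
  proof -
    define s where "s i = inverse (\<zeta> k) ^ i * e (z + smul (int i) v)" for i
    have "s n = s 0" using per[of z] \<zeta>n[of k] by (simp add: s_def power_inverse)
    then have shift: "(\<Sum>i<n. s (Suc i)) = (\<Sum>i<n. s i)"
      using sum.lessThan_Suc_shift[of s n] by simp
    have "inverse (\<zeta> k) ^ i * e (z + v + smul (int i) v) = \<zeta> k * s (Suc i)" for i
      using \<zeta>0[of k] by (simp add: s_def smul_algebra add.assoc)
    then have "E k (z + v) = \<zeta> k * (\<Sum>i<n. s (Suc i))"
      by (simp add: E_def sum_distrib_left)
    then show ?thesis unfolding shift by (simp add: E_def s_def)
  qed
  have finE: "finite (range (E k))" for k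
  proof -
    have "range (E k) \<subseteq> (\<lambda>f. \<Sum>i<n. inverse (\<zeta> k) ^ i * f i) ` ({..<n} \<rightarrow>\<^sub>E range e)"
    proof
      fix y assume "y \<in> range (E k)"
      then obtain z where "y = E k z" by blast
      then show "y \<in> (\<lambda>f. \<Sum>i<n. inverse (\<zeta> k) ^ i * f i) ` ({..<n} \<rightarrow>\<^sub>E range e)"
        by (intro image_eqI[where x = "\<lambda>i\<in>{..<n}. e (z + smul (int i) v)"]) (auto simp: E_def)
    qed
    then show ?thesis by (rule finite_subset) (intro finite_imageI finite_PiE fin finite_lessThan)
  qed
  have annE: "act g (E k) = (\<lambda>_. 0)" for k
  proof
    fix z
    have "act g (E k) z = (\<Sum>x\<in>Poly_Mapping.keys g. \<Sum>i<n.
        inverse (\<zeta> k) ^ i * (Poly_Mapping.lookup g x * e (z + smul (int i) v - x)))"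
      by (simp add: act_def E_def sum_distrib_left algebra_simps)
    also have "\<dots> = (\<Sum>i<n. inverse (\<zeta> k) ^ i * act g e (z + smul (int i) v))"
      unfolding act_def by (subst sum.swap) (simp add: sum_distrib_left)
    finally show "act g (E k) z = 0" using ann by simp
  qed
  have "\<forall>k. \<exists>h>0. \<forall>z. E k (z + smul (int h) u) = E k z"
    using eigenconfig_periodic[OF uni eig \<zeta>0 finE annE] ndvd \<zeta>0 by simp
  then obtain h where h: "\<And>k. h k > 0" "\<And>k z. E k (z + smul (int (h k)) u) = E k z"
    by metis
  \<comment> \<open>A common multiple of the periods of all components.\<close>
  define H where "H = (\<Prod>k<n. h k)"
  have perE: "E k (z + smul (int H) u) = E k z" if "k < n" for k z
  proof -
    have "h k dvd H" unfolding H_def using that by (intro dvd_prodI) auto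
    then obtain q where "H = q * h k" by (metis dvd_def mult.commute)
    then show ?thesis
      using period_smul[of "E k" "smul (int (h k)) u", OF h(2), of z "int q"] by (simp add: smul_smul)
  qed
  have inv: "(\<Sum>k<n. E k z) = of_nat n * e z" for z
  proof -
    have "(\<Sum>k<n. E k z) = (\<Sum>i<n. e (z + smul (int i) v) * (\<Sum>k<n. inverse (\<zeta> k) ^ i))"
      unfolding E_def by (subst sum.swap) (simp add: sum_distrib_left mult.commute)
    also have "\<dots> = (\<Sum>i<n. if i = 0 then of_nat n * e z else 0)"
      by (rule sum.cong) (auto simp: \<zeta>_def sum_powers_root_of_unity)
    also have "\<dots> = of_nat n * e z" using n by simp
    finally show ?thesis .
  qed
  have "e (z + smul (int H) u) = e z" for z
  proof -
    have "of_nat n * e (z + smul (int H) u) = of_nat n * e z"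
      unfolding inv[symmetric] by (simp add: perE)
    then show ?thesis using n by simp
  qed
  moreover have "H > 0" unfolding H_def using h(1) by (simp add: prod_pos)
  ultimately show ?thesis by blast
qed

lemma line_polynomial_binomial:
  assumes "v \<noteq> 0" "\<zeta> \<noteq> 0"
  shows "line_polynomial v (Poly_Mapping.single v 1 - Poly_Mapping.single 0 \<zeta>)"
proof -
  have keys: "Poly_Mapping.keys (Poly_Mapping.single v 1 - Poly_Mapping.single 0 \<zeta>) = {v, 0}"
    using assms by (auto simp: in_keys_iff lookup_minus lookup_single when_def split: if_splits)
  have "(of_int (fst v), of_int (snd v)) \<in> rat_span v" "(0, 0) \<in> rat_span v"
    unfolding rat_span_def by (auto intro: exI[of _ 1] exI[of _ 0])
  then show ?thesis
    unfolding line_polynomial_def keys using assms by (auto intro!: exI[of _ 0])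
qed

text \<open>For v = n v' with v' primitive, v' is not parallel to w, so no binomial X^v' - \<zeta>
  divides g. This gives a second period h u; v and h u generate a lattice of finite index, which
  contains a multiple of w.\<close>

lemma period_in_direction:
  fixes e :: "int \<times> int \<Rightarrow> int"
  assumes bounded: "\<And>z. \<bar>e z\<bar> \<le> B" and ann: "act g (\<lambda>z. of_int (e z)) = (\<lambda>_. 0)"
    and per: "\<And>z. e (z + v) = e z"
    and lines: "\<And>p v. p dvd g \<Longrightarrow> line_polynomial v p \<Longrightarrow> det2 v w = 0"
    and "det2 v w \<noteq> 0"
  shows "\<exists>m>0. \<forall>z. e (z + smul (int m) w) = e z"
proof -
  define n where "n = gcd (fst v) (snd v)"
  have "v \<noteq> 0" using \<open>det2 v w \<noteq> 0\<close> by (auto simp: det2_def)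
  then have n: "n > 0" by (auto simp: n_def prod_eq_iff)
  define v' where "v' = (fst v div n, snd v div n)"
  have v: "v = smul n v'" by (simp add: v'_def n_def smul_def)
  \<comment> \<open>Bezout coefficients complete v' to a basis of determinant one.\<close>
  obtain x y where xy: "x * fst v' + y * snd v' = 1"
    using bezout_int[of "fst v'" "snd v'"] \<open>v \<noteq> 0\<close> unfolding v'_def n_def
    by (auto simp: prod_eq_iff div_gcd_coprime coprime_iff_gcd_eq_1 simp flip: coprime_iff_gcd_eq_1)
  define u where "u = (- y, x)"
  have uni: "det2 v' u = 1" using xy by (simp add: u_def det2_def algebra_simps)
  have "det2 v w = n * det2 v' w" unfolding v by (simp add: smul_def det2_def algebra_simps)
  then have "det2 v' w \<noteq> 0" "v' \<noteq> 0" using \<open>det2 v w \<noteq> 0\<close> by (auto simp: det2_def)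
  then have ndvd: "\<not> Poly_Mapping.single v' 1 - Poly_Mapping.single 0 \<zeta> dvd g" if "\<zeta> \<noteq> 0" for \<zeta>
    using lines line_polynomial_binomial that by blast
  have "range e \<subseteq> {-B..B}" using bounded by (auto simp: abs_le_iff minus_le_iff)
  then have "finite (range e)" by (rule finite_subset) simp
  then have fin: "finite (range (\<lambda>z. complex_of_int (e z)))"
    using finite_imageI[of "range e" complex_of_int] by (simp add: image_image)
  obtain h where h: "h > 0" "\<And>z. complex_of_int (e (z + smul (int h) u)) = of_int (e z)"
    using transverse_period[of v' u "nat n" "\<lambda>z. of_int (e z)" g, OF uni _ _ fin ann ndvd] n per v
    by auto
  then have perh: "e (z + smul (int h) u) = e z" for z by simp
  define i j where "i = det2 w u" and "j = det2 v' w"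
  have w: "w = smul i v' + smul j u"
    using unimodular_coordinates[OF uni, of w] by (simp add: i_def j_def)
  have "e (z + smul (int (nat n * h)) w) = e z" for z
  proof -
    have "smul (int (nat n * h)) w = smul (i * int h) v + smul (j * n) (smul (int h) u)"
      unfolding w v using n by (simp add: smul_algebra smul_smul mult_ac)
    then show ?thesis
      using period_smul[of e, OF perh, of "z + smul (i * int h) v"] period_smul[of e, OF per]
      by (simp add: add.assoc)
  qed
  then show ?thesis using n h by (intro exI[of _ "nat n * h"]) simp
qed

section \<open>Collapsing a product of differences to one period\<close>

lemma diff_eq_0D: "diff v e = (\<lambda>_. 0) \<Longrightarrow> e (z + v) = e z"
  unfolding diff_eq_0_iff by blast

lemma diff_const [simp]: "diff v (\<lambda>_. k) = (\<lambda>_. 0)"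
  by (rule ext) (simp add: diff_def)

lemma diff_bounded:
  assumes "\<And>z. \<bar>e z\<bar> \<le> (B :: int)"
  shows "\<bar>diff v e z\<bar> \<le> 2 * B"
  using assms[of z] assms[of "z + v"] by (simp add: diff_def)

text \<open>A vanishing second difference makes e affine along w, and a bounded affine sequence is
  constant.\<close>

lemma diff_diff_eq_0_bounded:
  assumes bounded: "\<And>z. \<bar>e z\<bar> \<le> (B :: int)" and "diff w (diff w e) = (\<lambda>_. 0)"
  shows "diff w e = (\<lambda>_. 0)"
proof
  fix z
  define d where "d = diff w e z"
  have "diff w e (z + w) = diff w e z" for z
    using assms(2) by (rule diff_eq_0D)
  then have per: "diff w e (z + smul k w) = d" for k
    unfolding d_def by (rule period_smul)
  have "e (z + smul (int n) w) = e z + int n * d" for n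
  proof (induction n)
    case (Suc n)
    have "e (z + smul (int (Suc n)) w) = e (z + smul (int n) w) + diff w e (z + smul (int n) w)"
      by (simp add: diff_def smul_algebra algebra_simps)
    then show ?case using Suc per by (simp add: algebra_simps)
  qed simp
  then have "int n * d = e (z + smul (int n) w) - e z" for n by simp
  then have "int n * \<bar>d\<bar> = \<bar>e (z + smul (int n) w) - e z\<bar>" for n
    by (metis abs_mult abs_of_nat)
  moreover have "\<bar>e (z + smul (int n) w) - e z\<bar> \<le> 2 * B" for n
    using bounded[of z] bounded[of "z + smul (int n) w"] by linarith
  ultimately have le: "int n * \<bar>d\<bar> \<le> 2 * B" for n by simp
  have "B \<ge> 0" using bounded[of z] by simp
  show "diff w e z = 0"
  proof (rule ccontr)
    assume "diff w e z \<noteq> 0"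
    \<comment> \<open>After 2 B + 1 steps a non-zero slope exceeds the largest possible variation 2
      B.\<close>
    then have "(2 * B + 1) * 1 \<le> (2 * B + 1) * \<bar>d\<bar>"
      using \<open>B \<ge> 0\<close> by (intro mult_left_mono) (auto simp: d_def)
    moreover have "int (nat (2 * B + 1)) = 2 * B + 1" using \<open>B \<ge> 0\<close> by simp
    ultimately show False using le[of "nat (2 * B + 1)"] by (metis mult_1_right not_less order_trans zless_add1_eq)
  qed
qed

lemma parallel_multiples:
  assumes "det2 v w = 0" "v \<noteq> 0" "w \<noteq> 0"
  obtains k l where "k \<noteq> 0" "l \<noteq> 0" "smul k v = smul l w"
proof (cases "fst w = 0")
  case True
  then have "snd w \<noteq> 0" "fst v = 0" using assms by (auto simp: det2_def prod_eq_iff)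
  then show ?thesis using that[of "snd w" "snd v"] True assms
    by (auto simp: smul_def prod_eq_iff)
next
  case False
  then have "fst v \<noteq> 0" using assms by (auto simp: det2_def prod_eq_iff)
  then show ?thesis using that[of "fst w" "fst v"] False assms
    by (auto simp: smul_def det2_def algebra_simps)
qed

text \<open>The list is peeled at its end, where \<open>foldr\<close> applies the first difference.
  Boundedness is invoked at every step, so that the induction carries a single period along w
  instead of a growing power; B varies because a difference doubles the bound.\<close>

lemma period_of_differences:
  fixes e :: "int \<times> int \<Rightarrow> int"
  assumes "\<And>z. \<bar>e z\<bar> \<le> B" and "act g (\<lambda>z. of_int (e z)) = (\<lambda>_. 0)"
    and "foldr diff vs e = (\<lambda>_. 0)" and "0 \<notin> set vs" and "w \<noteq> 0"
    and lines: "\<And>p v. p dvd g \<Longrightarrow> line_polynomial v p \<Longrightarrow> det2 v w = 0"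
  shows "\<exists>m>0. \<forall>z. e (z + smul (int m) w) = e z"
  using assms(1-5)
proof (induction vs arbitrary: e B rule: rev_induct)
  case Nil
  then show ?case by (intro exI[of _ 1]) (auto simp: fun_eq_iff simp del: split_paired_All)
next
  case (snoc v vs)
  have complexify: "(\<lambda>z. complex_of_int (diff x e z)) = diff x (\<lambda>z. of_int (e z))" for x
    by (simp add: diff_def fun_eq_iff)
  have ann: "act g (\<lambda>z. of_int (diff x e z)) = (\<lambda>_. 0)" for x
    unfolding complexify act_diff_commute snoc.prems by simp
  obtain m where m: "m > 0" "\<And>z. diff v e (z + smul (int m) w) = diff v e z"
    using snoc.IH[of "diff v e" "2 * B", OF diff_bounded[OF snoc.prems(1)] ann] snoc.prems by auto
  define f where "f = diff (smul (int m) w) e"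
  have "diff v f = (\<lambda>_. 0)"
    using m(2) unfolding f_def by (subst diff_commute) (simp add: diff_eq_0_iff)
  then have perv: "f (z + v) = f z" for z by (rule diff_eq_0D)
  \<comment> \<open>f has period v. If v is parallel to w, a common multiple is a period along w;
    otherwise the absence of line factors in direction v provides one.\<close>
  have "\<exists>m'>0. \<forall>z. f (z + smul (int m') w) = f z"
  proof (cases "det2 v w = 0")
    case True
    then obtain k l where kl: "k \<noteq> 0" "l \<noteq> 0" "smul k v = smul l w"
      using parallel_multiples snoc.prems by (metis in_set_conv_decomp)
    have "smul \<bar>l\<bar> w = smul (sgn l * k) v"
      using kl(3) by (metis abs_sgn mult.commute smul_smul)
    then show ?thesis
      using kl period_smul[of f v, OF perv] by (intro exI[of _ "nat \<bar>l\<bar>"]) simp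
  next
    case False
    have "\<bar>f z\<bar> \<le> 2 * B" for z unfolding f_def by (rule diff_bounded[OF snoc.prems(1)])
    moreover have "act g (\<lambda>z. of_int (f z)) = (\<lambda>_. 0)" unfolding f_def by (rule ann)
    ultimately show ?thesis using perv lines False by (rule period_in_direction)
  qed
  then obtain m' where m': "m' > 0" "\<And>z. f (z + smul (int m') w) = f z" by blast
  \<comment> \<open>A common multiple of both steps: \<open>diff W e\<close> has period m w, hence
    period \<open>W\<close>, so the second difference along \<open>W\<close> vanishes.\<close>
  define W where "W = smul (int (m * m')) w"
  have "f (z + W) = f z" for z
    using period_smul[of f, OF m'(2), of z "int m"] by (simp add: W_def smul_smul)
  then have "diff (smul (int m) w) (diff W e) = (\<lambda>_. 0)"
    unfolding f_def by (subst diff_commute) (simp add: diff_eq_0_iff)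
  then have "diff W e (z + smul (int m) w) = diff W e z" for z by (rule diff_eq_0D)
  then have "diff W e (z + smul (int m') (smul (int m) w)) = diff W e z" for z
    by (rule period_smul)
  then have "diff W (diff W e) = (\<lambda>_. 0)"
    unfolding diff_eq_0_iff by (simp add: W_def smul_smul mult.commute)
  from diff_diff_eq_0_bounded[OF snoc.prems(1) this] show ?case
    using m m' by (intro exI[of _ "m * m'"]) (simp add: diff_eq_0_iff W_def)
qed

section \<open>From the hypothesis on factors to one period of a covering\<close>

lemma parallel_det2: "parallel v w \<Longrightarrow> det2 v w = 0"
proof -
  assume "parallel v w"
  then obtain t where "of_int (fst w) = t * (of_int (fst v) :: rat)"
    "of_int (snd w) = t * (of_int (snd v) :: rat)"
    unfolding parallel_def rat_span_def by auto
  then have "(of_int (fst v * snd w) :: rat) = of_int (snd v * fst w)" by simp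
  then show ?thesis unfolding det2_def by (simp only: of_int_eq_iff)
qed

lemma ex_common_direction:
  assumes "line_factors_at_most_one_direction g"
  obtains w where "w \<noteq> 0" "\<And>p v. p dvd g \<Longrightarrow> line_polynomial v p \<Longrightarrow> det2 v w = 0"
proof (cases "\<exists>q w. q dvd g \<and> line_polynomial w q")
  case True
  then obtain q w where q: "q dvd g" "line_polynomial w q" by blast
  then have "w \<noteq> 0" by (simp add: line_polynomial_def)
  moreover have "det2 v w = 0" if "p dvd g" "line_polynomial v p" for p v
    using assms q that parallel_det2 unfolding line_factors_at_most_one_direction_def by blast
  ultimately show ?thesis using that by blast
next
  case False
  \<comment> \<open>Without line factors any non-zero w serves.\<close>
  then show ?thesis using that[of "(1, 0)"] by (auto simp: zero_prod_def)
qed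

lemma card_ones_eq_sum:
  fixes D :: "(int \<times> int) set"
  assumes "finite D" "\<And>z. c z \<in> {0, 1 :: nat}"
  shows "card {z \<in> (+) u ` D. c z = 1} = (\<Sum>d\<in>D. c (u + d))"
proof -
  let ?A = "(+) u ` D"
  have c: "c z = (if c z = 1 then 1 else 0)" for z using assms(2)[of z] by auto
  have "(\<Sum>z\<in>?A. c z) = (\<Sum>z\<in>?A. if c z = 1 then 1 else 0)"
    by (rule sum.cong[OF refl c])
  also have "\<dots> = card {z \<in> ?A. c z = 1}"
    using assms(1) by (simp add: sum.If_cases Int_def)
  finally have "card {z \<in> ?A. c z = 1} = (\<Sum>z\<in>?A. c z)" by simp
  also have "\<dots> = (\<Sum>d\<in>D. c (u + d))"
    by (subst sum.reindex) (auto simp: inj_on_def)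
  finally show ?thesis .
qed

lemma covering_iff:
  assumes "finite D"
  shows "covering D b a c \<longleftrightarrow> (\<forall>u. c u \<in> {0, 1}) \<and>
    (\<forall>u. (\<Sum>d\<in>D. c (u + d)) = (if c u = 1 then b else a))"
  unfolding covering_def using card_ones_eq_sum[OF assms, of c]
  by (metis One_nat_def empty_iff insert_iff zero_neq_one)

lemma covering_periodic:
  assumes "finite D" and cov: "covering D b a c"
    and one: "line_factors_at_most_one_direction
      (char_laurent D - laurent_const (of_nat b - of_nat a))"
  shows "\<exists>v. v \<noteq> 0 \<and> (\<forall>z. c (z + v) = c z)"
proof -
  define g where "g = char_laurent D - laurent_const (of_nat b - of_nat a)"
  \<comment> \<open>The integer twin of g, in the ring where reduction modulo primes makes
    sense.\<close>
  define g' :: "(int \<times> int) \<Rightarrow>\<^sub>0 int" where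
    "g' = (\<Sum>u\<in>D. Poly_Mapping.single (- u) 1) - Poly_Mapping.single 0 (int b - int a)"
  obtain w where w: "w \<noteq> 0" "\<And>p v. p dvd g \<Longrightarrow> line_polynomial v p \<Longrightarrow> det2 v w = 0"
    using ex_common_direction[OF one] unfolding g_def by blast
  define c' where "c' z = int (c z)" for z
  define e where "e = diff w c'"
  have c01: "c z = 0 \<or> c z = 1" for z using cov unfolding covering_def by blast
  have bc: "\<bar>c' z\<bar> \<le> 1" for z using c01[of z] by (auto simp: c'_def)
  have be: "\<bar>e z\<bar> \<le> 2" for z using diff_bounded[of c' 1, OF bc] by (simp add: e_def)
  have actg': "act g' f z = (\<Sum>u\<in>D. f (z + u)) - (int b - int a) * f z" for f z
    by (simp add: g'_def act_diff act_sum)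
  have actg: "act g f z = (\<Sum>u\<in>D. f (z + u)) - (of_nat b - of_nat a) * f z" for f z
    by (simp add: g_def char_laurent_def laurent_const_def act_diff act_sum)
  \<comment> \<open>Both cases of the covering condition give a: b - (b - a) at a one, a - 0 at a
    zero.\<close>
  have "act g' c' = (\<lambda>_. int a)"
  proof
    fix z
    have "(\<Sum>u\<in>D. c' (z + u)) = int (\<Sum>u\<in>D. c (z + u))" by (simp add: c'_def)
    also have "(\<Sum>u\<in>D. c (z + u)) = (if c z = 1 then b else a)"
      using cov unfolding covering_iff[OF assms(1)] by blast
    finally show "act g' c' z = int a" using c01[of z] by (auto simp: actg' c'_def)
  qed
  then have ann': "act g' e = (\<lambda>_. 0)"
    unfolding e_def act_diff_commute by simp
  have ann: "act g (\<lambda>z. of_int (e z)) = (\<lambda>_. 0)"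
  proof
    fix z
    have "act g (\<lambda>z. of_int (e z)) z = of_int (act g' e z)" by (simp add: actg actg')
    then show "act g (\<lambda>z. of_int (e z)) z = 0" by (simp add: ann')
  qed
  \<comment> \<open>If g were zero, every binomial would divide it, and w would be parallel to both
    axes.\<close>
  have "g' \<noteq> 0"
  proof
    assume "g' = 0"
    have coeff: "Poly_Mapping.lookup g u = of_int (Poly_Mapping.lookup g' u)" for u
    proof -
      have s1: "Poly_Mapping.lookup (Poly_Mapping.single k 1) u =
          (of_int (Poly_Mapping.lookup (Poly_Mapping.single k 1) u) :: complex)" for k
        by (simp add: lookup_single when_def)
      have s2: "Poly_Mapping.lookup (Poly_Mapping.single 0 (of_nat b - of_nat a)) u =
          (of_int (Poly_Mapping.lookup (Poly_Mapping.single 0 (int b - int a)) u) :: complex)"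
        by (simp add: lookup_single when_def)
      have "Poly_Mapping.lookup g u = (\<Sum>d\<in>D. Poly_Mapping.lookup (Poly_Mapping.single (- d) 1) u) -
          Poly_Mapping.lookup (Poly_Mapping.single 0 (of_nat b - of_nat a)) u"
        by (simp only: g_def char_laurent_def laurent_const_def lookup_minus lookup_sum)
      also have "\<dots> = of_int (Poly_Mapping.lookup g' u)"
        by (simp only: g'_def lookup_minus lookup_sum s1 s2 of_int_sum of_int_diff)
      finally show ?thesis .
    qed
    have "g = 0" by (rule poly_mapping_eqI) (simp add: coeff \<open>g' = 0\<close>)
    then have "det2 v w = 0" if "v \<noteq> 0" for v
      using w(2)[OF _ line_polynomial_binomial[OF that, of 1]] by simp
    from this[of "(1, 0)"] this[of "(0, 1)"] have "snd w = 0" "fst w = 0"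
      by (simp_all add: det2_def zero_prod_def)
    then show False using w(1) by (simp add: prod_eq_iff)
  qed
  obtain vs where vs: "0 \<notin> set vs" "foldr diff vs e = (\<lambda>_. 0)"
    by (rule ex_difference_annihilator[OF be ann' \<open>g' \<noteq> 0\<close>])
  have "\<exists>m>0. \<forall>z. e (z + smul (int m) w) = e z"
    by (rule period_of_differences[OF be ann vs(2,1) w])
  then obtain m where m: "m > 0" "\<And>z. e (z + smul (int m) w) = e z" by blast
  let ?W = "smul (int m) w"
  \<comment> \<open>The difference of c along m w has period w, hence period m w, so the second
    difference along m w vanishes.\<close>
  have "diff w (diff ?W c') = (\<lambda>_. 0)"
    using m(2) unfolding e_def by (subst diff_commute) (simp add: diff_eq_0_iff)
  then have "diff ?W c' (z + w) = diff ?W c' z" for z by (rule diff_eq_0D)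
  then have "diff ?W c' (z + ?W) = diff ?W c' z" for z by (rule period_smul)
  then have "diff ?W (diff ?W c') = (\<lambda>_. 0)" by (intro diff_eq_0_iff[THEN iffD2] allI)
  from diff_diff_eq_0_bounded[OF bc this] have "c' (z + ?W) = c' z" for z by (rule diff_eq_0D)
  then have "c (z + ?W) = c z" for z by (simp add: c'_def)
  then show ?thesis using m w(1) by (intro exI[of _ ?W]) simp
qed

section \<open>Recursive functions\<close>

text \<open>Totality on lists of one fixed length. Variables are list positions, and each bound
  variable of a sum or recursion is put in front.\<close>

definition recursive :: "nat \<Rightarrow> (nat list \<Rightarrow> nat) \<Rightarrow> bool" where
  "recursive k f \<longleftrightarrow> (\<exists>r. \<forall>xs. length xs = k \<longrightarrow> run r xs = Some (f xs))"

lemma recursive_cong: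
  assumes "recursive k f" and "\<And>xs. length xs = k \<Longrightarrow> f xs = g xs"
  shows "recursive k g"
  using assms unfolding recursive_def by metis

lemma those_map_Some:
  assumes "\<And>x. x \<in> set xs \<Longrightarrow> f x = Some (g x)"
  shows "those (map f xs) = Some (map g xs)"
  using assms by (induction xs) auto

lemma recursive_nth [intro]: "i < k \<Longrightarrow> recursive k (\<lambda>xs. xs ! i)"
  unfolding recursive_def by (rule exI[of _ "Proj i"]) simp

lemma recursive_hd: "0 < k \<Longrightarrow> recursive k hd"
  by (rule recursive_cong[OF recursive_nth[of 0]]) (auto simp: hd_conv_nth)

lemma recursive_comp_list:
  assumes "recursive (length fs) f" and "\<And>h. h \<in> set fs \<Longrightarrow> recursive k h"
  shows "recursive k (\<lambda>xs. f (map (\<lambda>h. h xs) fs))"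
proof -
  obtain r where r: "\<And>ys. length ys = length fs \<Longrightarrow> run r ys = Some (f ys)"
    using assms(1) unfolding recursive_def by blast
  have "\<forall>h\<in>set fs. \<exists>s. \<forall>xs. length xs = k \<longrightarrow> run s xs = Some (h xs)"
    using assms(2) unfolding recursive_def by blast
  then obtain S where S: "\<And>h xs. h \<in> set fs \<Longrightarrow> length xs = k \<Longrightarrow> run (S h) xs = Some (h xs)"
    by metis
  have "run (Comp r (map S fs)) xs = Some (f (map (\<lambda>h. h xs) fs))" if "length xs = k" for xs
  proof -
    have "those (map (\<lambda>g. run g xs) (map S fs)) = Some (map (\<lambda>h. h xs) fs)"
      unfolding map_map by (rule those_map_Some) (simp add: S that)
    then show ?thesis by (simp add: r)
  qed
  then show ?thesis unfolding recursive_def by blast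
qed

text \<open>Weakening by one further variable in front.\<close>

lemma recursive_tl:
  assumes "recursive k f"
  shows "recursive (Suc k) (\<lambda>xs. f (tl xs))"
proof -
  let ?fs = "map (\<lambda>i xs. xs ! Suc i) [0..<k]"
  have "recursive (Suc k) (\<lambda>xs. f (map (\<lambda>h. h xs) ?fs))"
    by (rule recursive_comp_list) (use assms in auto)
  then show ?thesis
  proof (rule recursive_cong)
    fix xs :: "nat list" assume "length xs = Suc k"
    then have "map (\<lambda>h. h xs) ?fs = tl xs"
      by (intro nth_equalityI) (auto simp: nth_tl)
    then show "f (map (\<lambda>h. h xs) ?fs) = f (tl xs)" by simp
  qed
qed

lemma recursive_comp_Cons:
  assumes "recursive (Suc k) f" and "recursive k g"
  shows "recursive k (\<lambda>xs. f (g xs # xs))"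
proof -
  let ?fs = "g # map (\<lambda>i xs. xs ! i) [0..<k]"
  have "recursive k (\<lambda>xs. f (map (\<lambda>h. h xs) ?fs))"
    by (rule recursive_comp_list) (use assms in auto)
  then show ?thesis
  proof (rule recursive_cong)
    fix xs :: "nat list" assume "length xs = k"
    then have "map (\<lambda>h. h xs) ?fs = g xs # xs"
      by (auto intro!: nth_equalityI)
    then show "f (map (\<lambda>h. h xs) ?fs) = f (g xs # xs)" by simp
  qed
qed

text \<open>The arguments of the step come in the order of \<open>Prim\<close>: index, previous
  value, parameters.\<close>

lemma recursive_rec_nat:
  assumes "recursive k f"
    and "recursive (Suc (Suc k)) (\<lambda>ys. g (tl (tl ys)) (hd ys) (hd (tl ys)))"
    and "recursive k n"
  shows "recursive k (\<lambda>xs. rec_nat (f xs) (g xs) (n xs))"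
proof -
  obtain r where r: "\<And>xs. length xs = k \<Longrightarrow> run r xs = Some (f xs)"
    using assms(1) unfolding recursive_def by blast
  obtain s where s: "\<And>ys. length ys = Suc (Suc k) \<Longrightarrow>
      run s ys = Some (g (tl (tl ys)) (hd ys) (hd (tl ys)))"
    using assms(2) unfolding recursive_def by blast
  have "run (Prim r s) (m # xs) = Some (rec_nat (f xs) (g xs) m)" if "length xs = k" for m xs
    by (induction m) (simp_all add: r s that)
  then have "recursive (Suc k) (\<lambda>ys. rec_nat (f (tl ys)) (g (tl ys)) (hd ys))"
    unfolding recursive_def
    by (intro exI[of _ "Prim r s"]) (auto simp: length_Suc_conv simp del: run.simps)
  from recursive_comp_Cons[OF this assms(3)] show ?thesis by simp
qed

section \<open>Arithmetic functions\<close>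

lemma recursive_const: "recursive k (\<lambda>xs. n)"
proof (induction n)
  case 0
  show ?case unfolding recursive_def by (rule exI[of _ Zero]) simp
next
  case (Suc n)
  then obtain r where "\<And>xs. length xs = k \<Longrightarrow> run r xs = Some n"
    unfolding recursive_def by blast
  then show ?case unfolding recursive_def by (intro exI[of _ "Comp Succ [r]"]) simp
qed

lemma recursive_Suc:
  assumes "recursive k f"
  shows "recursive k (\<lambda>xs. Suc (f xs))"
proof -
  obtain r where "\<And>xs. length xs = k \<Longrightarrow> run r xs = Some (f xs)"
    using assms unfolding recursive_def by blast
  then show ?thesis unfolding recursive_def by (intro exI[of _ "Comp Succ [r]"]) simp
qed

lemma recursive_hd_tl: "1 < k \<Longrightarrow> recursive k (\<lambda>xs. hd (tl xs))"
  by (metis recursive_tl recursive_hd Suc_lessE One_nat_def)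

lemma recursive_tl_tl:
  assumes "recursive k f"
  shows "recursive (Suc (Suc k)) (\<lambda>xs. f (tl (tl xs)))"
  by (rule recursive_tl[OF recursive_tl[OF assms]])

lemma recursive_add:
  assumes "recursive k f" "recursive k g"
  shows "recursive k (\<lambda>xs. f xs + g xs)"
proof -
  have "recursive k (\<lambda>xs. rec_nat (f xs) (\<lambda>_ y. Suc y) (g xs))"
    by (intro recursive_rec_nat assms recursive_Suc recursive_hd_tl) simp
  moreover have "rec_nat m (\<lambda>_ y. Suc y) n = m + n" for m n :: nat by (induction n) auto
  ultimately show ?thesis by simp
qed

lemma recursive_sum:
  assumes "recursive (Suc k) (\<lambda>ys. g (tl ys) (hd ys))" and "recursive k n"
  shows "recursive k (\<lambda>xs. \<Sum>i<n xs. g xs i)"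
proof -
  \<comment> \<open>Recursion places the accumulator between index and parameters; the summand has
    to skip it.\<close>
  have *: "recursive (Suc (Suc k)) (\<lambda>ys. g (tl (tl ys)) (hd ys))"
  proof -
    let ?fs = "hd # map (\<lambda>i xs. xs ! Suc (Suc i)) [0..<k]"
    have "recursive (Suc (Suc k)) (\<lambda>xs. (\<lambda>ys. g (tl ys) (hd ys)) (map (\<lambda>h. h xs) ?fs))"
      by (rule recursive_comp_list) (use assms recursive_hd in auto)
    then show ?thesis
    proof (rule recursive_cong)
      fix xs :: "nat list" assume "length xs = Suc (Suc k)"
      then have "map (\<lambda>h. h xs) ?fs = hd xs # tl (tl xs)"
        by (auto intro!: nth_equalityI simp: length_Suc_conv)
      then show "(\<lambda>ys. g (tl ys) (hd ys)) (map (\<lambda>h. h xs) ?fs) = g (tl (tl xs)) (hd xs)"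
        by simp
    qed
  qed
  have "recursive k (\<lambda>xs. rec_nat 0 (\<lambda>i y. y + g xs i) (n xs))"
    by (intro recursive_rec_nat assms recursive_const recursive_add recursive_hd_tl *) simp
  moreover have "rec_nat 0 (\<lambda>i y. y + h i) m = (\<Sum>i<m. h i)" for h :: "nat \<Rightarrow> nat" and m
    by (induction m) auto
  ultimately show ?thesis by simp
qed

lemma recursive_mult:
  assumes "recursive k f" "recursive k g"
  shows "recursive k (\<lambda>xs. f xs * g xs)"
proof -
  have "recursive k (\<lambda>xs. \<Sum>i<f xs. g xs)"
    by (intro recursive_sum assms recursive_tl)
  then show ?thesis by simp
qed

lemma recursive_power:
  assumes "recursive k f" "recursive k g"
  shows "recursive k (\<lambda>xs. f xs ^ g xs)"
proof -
  have "recursive k (\<lambda>xs. rec_nat 1 (\<lambda>_ y. f xs * y) (g xs))"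
    by (intro recursive_rec_nat assms recursive_const recursive_mult recursive_hd_tl
        recursive_tl_tl) simp
  moreover have "rec_nat 1 (\<lambda>_ y. m * y) n = m ^ n" for m n :: nat by (induction n) auto
  ultimately show ?thesis by simp
qed

lemma recursive_diff:
  assumes "recursive k f" "recursive k g"
  shows "recursive k (\<lambda>xs. f xs - g xs)"
proof -
  have "recursive 1 (\<lambda>xs. rec_nat 0 (\<lambda>m _. m) (hd xs))"
    by (intro recursive_rec_nat recursive_const recursive_hd) simp_all
  moreover have "rec_nat 0 (\<lambda>m _. m) n = n - 1" for n :: nat by (cases n) auto
  ultimately have "recursive 1 (\<lambda>xs. hd xs - 1)" by simp
  then have pred: "recursive j (\<lambda>xs. h xs - 1)" if "recursive j h" for j h
    using recursive_comp_list[of "[h]" "\<lambda>xs. hd xs - 1" j] that by simp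
  have "recursive k (\<lambda>xs. rec_nat (f xs) (\<lambda>_ y. y - 1) (g xs))"
    by (intro recursive_rec_nat assms pred recursive_hd_tl) simp
  moreover have "rec_nat m (\<lambda>_ y. y - 1) n = m - n" for m n :: nat by (induction n) auto
  ultimately show ?thesis by simp
qed

text \<open>The sum counts the positive multiples of n up to m. The leading factor is the sign of n
  and yields the convention \<open>m div 0 = 0\<close>.\<close>

lemma div_eq_sum: "m div n = (1 - (1 - n)) * (\<Sum>i<m. 1 - (Suc i * n - m))" for m n :: nat
proof (cases "n = 0")
  case False
  have "(\<Sum>i<m. 1 - (Suc i * n - m)) = (\<Sum>i<m. if i < m div n then 1 else 0)"
  proof (rule sum.cong)
    fix i
    have "Suc i * n \<le> m \<longleftrightarrow> i < m div n"
      using less_eq_div_iff_mult_less_eq[of n "Suc i" m] False by (simp add: Suc_le_eq)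
    then show "1 - (Suc i * n - m) = (if i < m div n then 1 else 0)" by auto
  qed simp
  also have "\<dots> = card {i \<in> {..<m}. i < m div n}" by (simp add: sum.If_cases Int_def)
  also have "{i \<in> {..<m}. i < m div n} = {..<m div n}"
    using div_le_dividend[of m n] by (auto intro: less_le_trans)
  finally show ?thesis using False by simp
qed simp

lemma recursive_div:
  assumes "recursive k f" "recursive k g"
  shows "recursive k (\<lambda>xs. f xs div g xs)"
  unfolding div_eq_sum
  by (intro recursive_mult recursive_diff recursive_const recursive_sum recursive_Suc
      recursive_tl assms recursive_hd) simp

lemma recursive_mod:
  assumes "recursive k f" "recursive k g"
  shows "recursive k (\<lambda>xs. f xs mod g xs)"
proof -
  have "recursive k (\<lambda>xs. f xs - f xs div g xs * g xs)"
    by (intro recursive_mult recursive_diff recursive_div assms)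
  then show ?thesis by (simp add: minus_div_mult_eq_mod)
qed

lemmas recursive_arith =
  recursive_const recursive_Suc recursive_add recursive_mult recursive_power recursive_diff
  recursive_div recursive_mod

text \<open>Unbounded search: as h is total, \<open>Mu\<close> reaches its first zero, and g is
  evaluated there.\<close>

lemma recursive_at_zero:
  assumes "recursive (Suc k) h" and "recursive (Suc k) g"
  shows "\<exists>r. \<forall>xs. length xs = k \<longrightarrow> (\<exists>n. h (n # xs) = 0) \<longrightarrow>
    (\<exists>n. h (n # xs) = 0 \<and> run r xs = Some (g (n # xs)))"
proof -
  obtain rh where rh: "\<And>xs. length xs = Suc k \<Longrightarrow> run rh xs = Some (h xs)"
    using assms(1) unfolding recursive_def by blast
  obtain rg where rg: "\<And>xs. length xs = Suc k \<Longrightarrow> run rg xs = Some (g xs)"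
    using assms(2) unfolding recursive_def by blast
  let ?r = "Comp rg (Mu rh # map Proj [0..<k])"
  have "\<exists>n. h (n # xs) = 0 \<and> run ?r xs = Some (g (n # xs))"
    if xs: "length xs = k" "\<exists>n. h (n # xs) = 0" for xs
  proof -
    define n where "n = (LEAST n. h (n # xs) = 0)"
    have n: "h (n # xs) = 0" unfolding n_def using xs(2) by (rule LeastI_ex)
    have "\<exists>k. h (m # xs) = Suc k" if "m < n" for m
      using not_less_Least[of m "\<lambda>n. h (n # xs) = 0"] that unfolding n_def
      by (cases "h (m # xs)") auto
    then have mu: "run (Mu rh) xs = Some n"
      using n xs unfolding n_def by (auto simp: mu_search_def rh)
    have "those (map (\<lambda>g. run g xs) (map Proj [0..<k])) = Some (map (\<lambda>i. xs ! i) [0..<k])"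
      unfolding map_map by (rule those_map_Some) (simp add: xs)
    also have "map (\<lambda>i. xs ! i) [0..<k] = xs" using xs by (metis map_nth)
    finally have "those (map (\<lambda>g. run g xs) (Mu rh # map Proj [0..<k])) = Some (n # xs)"
      using mu by simp
    then have "run ?r xs = run rg (n # xs)" by (simp del: list.map)
    then show ?thesis using n rg[of "n # xs"] xs by auto
  qed
  then show ?thesis by blast
qed

section \<open>Doubly periodic coverings\<close>

lemma det2_simps:
  "det2 v (x + y) = det2 v x + det2 v y" "det2 v (x - y) = det2 v x - det2 v y"
  "det2 v (smul k x) = k * det2 v x" "det2 v v = 0"
  by (auto simp: det2_def smul_def algebra_simps)

lemma smul_det2:
  "smul (det2 v u) x = smul (det2 x u) v + smul (det2 v x) u"
  by (auto simp: prod_eq_iff smul_def det2_def algebra_simps)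

text \<open>The determinant and the scalar product with v are coordinates along orthogonal axes;
  they determine |v|^2 z and hence z.\<close>

lemma finite_parallelogram:
  assumes "v \<noteq> 0"
  shows "finite {z. 0 \<le> det2 v z \<and> det2 v z < H \<and>
    0 \<le> fst v * fst z + snd v * snd z \<and> fst v * fst z + snd v * snd z < N}"
    (is "finite ?F")
proof (rule inj_on_finite)
  let ?f = "\<lambda>z. (det2 v z, fst v * fst z + snd v * snd z)"
  have "fst v * fst v + snd v * snd v > 0"
    using assms by (auto simp: prod_eq_iff sum_squares_gt_zero_iff)
  then have ne: "fst v * fst v + snd v * snd v \<noteq> 0" by linarith
  have coord: "(fst v * fst v + snd v * snd v) * fst z =
      fst v * (fst v * fst z + snd v * snd z) - snd v * det2 v z"
    "(fst v * fst v + snd v * snd v) * snd z =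
      snd v * (fst v * fst z + snd v * snd z) + fst v * det2 v z" for z
    by (simp_all add: det2_def algebra_simps)
  show "inj_on ?f ?F"
  proof (rule inj_onI)
    fix y z assume "?f y = ?f z"
    then have "(fst v * fst v + snd v * snd v) * fst y = (fst v * fst v + snd v * snd v) * fst z"
      "(fst v * fst v + snd v * snd v) * snd y = (fst v * fst v + snd v * snd v) * snd z"
      unfolding coord by simp_all
    then have "fst y = fst z" "snd y = snd z" using ne mult_cancel_left by blast+
    then show "y = z" by (rule prod_eqI)
  qed
  show "?f ` ?F \<subseteq> {0..<H} \<times> {0..<N}" by auto
qed simp

text \<open>By the pigeonhole principle two translates of \<open>c\<close> agree on a strip parallel to \<open>v\<close> that is
  wider than the shape; the part of \<open>c\<close> between the two copies of the strip is then repeated.\<close>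

lemma covering_doubly_periodic:
  assumes "finite D" and cov: "covering D b a c" and "v \<noteq> 0" and per: "\<And>z. c (z + v) = c z"
  shows "\<exists>c' n. n > 0 \<and> covering D b a c' \<and> (\<forall>z x. c' (z + smul (int n) x) = c' z)"
proof -
  \<comment> \<open>v turned by a right angle: translation by q changes the determinant by
    \<open>N\<close> and keeps \<open>dot\<close>.\<close>
  define q where "q = (- snd v, fst v)"
  define N where "N = fst v * fst v + snd v * snd v"
  define dot where "dot z = fst v * fst z + snd v * snd z" for z
  have N: "N > 0" using \<open>v \<noteq> 0\<close> by (auto simp: N_def prod_eq_iff sum_squares_gt_zero_iff)
  have q: "det2 v q = N" by (simp add: q_def N_def det2_def)
  \<comment> \<open>\<open>R\<close> bounds the reach of the shape across v, and \<open>H\<close>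
    leaves room for it on both sides.\<close>
  define R where "R = (\<Sum>d\<in>D. \<bar>det2 v d\<bar>)"
  define H where "H = 2 * R + 1"
  have R: "\<bar>det2 v d\<bar> \<le> R" if "d \<in> D" for d
    unfolding R_def using that \<open>finite D\<close> by (intro member_le_sum) auto
  have R0: "R \<ge> 0" unfolding R_def by (simp add: sum_nonneg)
  \<comment> \<open>A fundamental domain of the strip modulo v, since adding v raises
    \<open>dot\<close> by \<open>N\<close>.\<close>
  define F where "F = {z. 0 \<le> det2 v z \<and> det2 v z < H \<and> 0 \<le> dot z \<and> dot z < N}"
  have finF: "finite F" unfolding F_def dot_def by (rule finite_parallelogram[OF \<open>v \<noteq> 0\<close>])
  have perk: "c (z + smul k v) = c z" for z k by (rule period_smul[of c, OF per])
  have c01: "c z \<in> {0, 1}" for z using cov unfolding covering_def by blast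
  define pat where "pat k = restrict (\<lambda>z. c (z + smul (int k) q)) F" for k :: nat
  have "pat k \<in> F \<rightarrow>\<^sub>E {0, 1}" for k
    unfolding pat_def restrict_PiE_iff using c01 by blast
  then have "pat ` UNIV \<subseteq> F \<rightarrow>\<^sub>E {0, 1}" by (rule image_subsetI)
  moreover have "finite (F \<rightarrow>\<^sub>E {0, 1 :: nat})" by (intro finite_PiE finF) simp
  ultimately have "finite (pat ` UNIV)" by (rule finite_subset)
  then obtain k0 where k0: "infinite {k. pat k = pat k0}"
    using pigeonhole_infinite[of "UNIV :: nat set" pat] by auto
  then obtain k1 where k1: "k1 > k0" "pat k1 = pat k0"
    unfolding infinite_nat_iff_unbounded by auto
  define c0 where "c0 z = c (z + smul (int k0) q)" for z
  define T where "T = smul (int (k1 - k0)) q"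
  define L where "L = det2 v T"
  have L: "L > 0" using k1 N by (simp add: L_def T_def det2_simps q)
  have strip: "c0 (z + T) = c0 z" if z: "0 \<le> det2 v z" "det2 v z < H" for z
  proof -
    define z' where "z' = z - smul (dot z div N) v"
    have "dot z' = dot z - dot z div N * N"
      by (simp add: z'_def dot_def N_def smul_def algebra_simps)
    then have "dot z' = dot z mod N" by (simp add: minus_div_mult_eq_mod)
    then have "z' \<in> F" using z N by (simp add: F_def z'_def det2_simps)
    then have eq: "c (z' + smul (int k1) q) = c (z' + smul (int k0) q)"
      using fun_cong[OF k1(2), of z'] by (simp add: pat_def)
    have "c (z + x) = c (z' + x)" for x
      using perk[of "z' + x" "dot z div N"] by (simp add: z'_def algebra_simps)
    moreover have "z + T + smul (int k0) q = z + smul (int k1) q"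
      using k1 by (simp add: T_def add.assoc flip: smul_algebra)
    ultimately show ?thesis unfolding c0_def by (simp only: eq)
  qed
  \<comment> \<open>Multiples of \<open>T\<close> move each point to a determinant between 0 and L -
    1, where \<open>c0\<close> is read.\<close>
  define c' where "c' z = c0 (z - smul (det2 v z div L) T)" for z
  have perT: "c' (z + T) = c' z" for z
    using L by (simp add: c'_def det2_simps flip: L_def) (simp add: smul_algebra)
  have c0v: "c0 (z + v) = c0 z" for z
    using per[of "z + smul (int k0) q"] by (simp add: c0_def algebra_simps)
  have perv: "c' (z + v) = c' z" for z
    using c0v[of "z - smul (det2 v z div L) T"] by (simp add: c'_def det2_simps algebra_simps)
  \<comment> \<open>By Cramer's rule L x is an integer combination of the periods v and
    \<open>T\<close>.\<close>
  have per': "c' (z + smul L x) = c' z" for z x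
    unfolding L_def smul_det2[of v T x] add.assoc[symmetric]
    by (simp only: period_smul[of c', OF perT] period_smul[of c', OF perv])
  \<comment> \<open>Equality extends past the period L by the strip width: each subtraction of
    \<open>T\<close> lands in the strip on which \<open>c0\<close> repeats.\<close>
  have agree: "c' z = c0 z" if z: "0 \<le> det2 v z" "det2 v z < L + H" for z
  proof -
    have "c0 (z - smul (int j) T) = c0 z" if "int j \<le> det2 v z div L" for j
      using that
    proof (induction j)
      case (Suc j)
      have "int (Suc j) * L \<le> det2 v z"
        using Suc.prems L by (metis mult.commute mult_le_cancel_left_pos order_trans
            div_mult_mod_eq le_add_same_cancel1 pos_mod_sign add.commute)
      moreover have "L \<le> int (Suc j) * L" using L by simp
      ultimately have "c0 (z - smul (int (Suc j)) T + T) = c0 (z - smul (int (Suc j)) T)"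
        using z by (intro strip) (auto simp: det2_simps simp flip: L_def)
      then show ?case using Suc by (simp add: smul_algebra algebra_simps)
    qed simp
    from this[of "nat (det2 v z div L)"] show ?thesis
      using z L by (simp add: c'_def pos_imp_zdiv_nonneg_iff)
  qed
  have "(\<Sum>d\<in>D. c' (u + d)) = (if c' u = 1 then b else a)" for u
  proof -
    \<comment> \<open>The representative of u modulo \<open>T\<close> at distance at least R from
      both ends of the region of agreement, so that u0 + D stays inside.\<close>
    define u0 where "u0 = u - smul ((det2 v u - R) div L) T"
    have "det2 v u0 - R = (det2 v u - R) mod L"
      by (simp add: u0_def det2_simps minus_div_mult_eq_mod[symmetric] flip: L_def)
    then have u0: "R \<le> det2 v u0" "det2 v u0 < R + L"
      using pos_mod_sign[OF L, of "det2 v u - R"] pos_mod_bound[OF L, of "det2 v u - R"] by linarith+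
    have shift: "c' (u + x) = c' (u0 + x)" for x
      using period_smul[of c' T, OF perT, of "u0 + x" "(det2 v u - R) div L"]
      by (simp add: u0_def algebra_simps)
    have "c' (u + d) = c0 (u0 + d)" if "d \<in> D" for d
      unfolding shift using R[OF that] u0 by (intro agree) (auto simp: det2_simps H_def)
    then have "(\<Sum>d\<in>D. c' (u + d)) = (\<Sum>d\<in>D. c (u0 + smul (int k0) q + d))"
      by (simp add: c0_def algebra_simps)
    also have "\<dots> = (if c (u0 + smul (int k0) q) = 1 then b else a)"
      using cov unfolding covering_iff[OF \<open>finite D\<close>] by blast
    also have "c (u0 + smul (int k0) q) = c' u0"
      using agree[of u0] u0 R0 by (simp add: c0_def H_def)
    finally show ?thesis using shift[of 0] by simp
  qed
  moreover have "c' u \<in> {0, 1}" for u unfolding c'_def c0_def by (rule c01)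
  ultimately have "covering D b a c'" unfolding covering_iff[OF \<open>finite D\<close>] by blast
  then show ?thesis using per' L by (intro exI[of _ c'] exI[of _ "nat L"]) simp
qed

section \<open>Compactness\<close>

text \<open>At stage m infinitely many sequences share a prefix of length m; as S is finite,
  infinitely many of these also share the next entry. The limit is read along the diagonal.\<close>

lemma ex_limit_sequence:
  fixes F :: "nat \<Rightarrow> nat \<Rightarrow> 'a"
  assumes "finite S" and FS: "\<And>n i. F n i \<in> S"
  shows "\<exists>c. \<forall>m. infinite {n. \<forall>i<m. F n i = c i}"
proof -
  have "\<exists>f. \<forall>m. infinite {n. \<forall>i<m. F n i = f m i} \<and> (\<forall>i<m. f (Suc m) i = f m i)"
  proof (rule dependent_nat_choice)
    show "\<exists>x. infinite {n. \<forall>i<0. F n i = x i}" by simp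
  next
    fix x :: "nat \<Rightarrow> 'a" and m
    assume inf: "infinite {n. \<forall>i<m. F n i = x i}" (is "infinite ?A")
    have "finite ((\<lambda>n. F n m) ` ?A)" by (rule finite_subset[OF _ \<open>finite S\<close>]) (use FS in auto)
    from pigeonhole_infinite[OF inf this] obtain n0 where
      "infinite {n \<in> ?A. F n m = F n0 m}" by blast
    moreover have "{n \<in> ?A. F n m = F n0 m} = {n. \<forall>i<Suc m. F n i = (x(m := F n0 m)) i}"
      by (auto simp: less_Suc_eq)
    ultimately show "\<exists>y. infinite {n. \<forall>i<Suc m. F n i = y i} \<and> (\<forall>i<m. y i = x i)"
      by (intro exI[of _ "x(m := F n0 m)"]) simp
  qed
  then obtain f where f: "\<And>m. infinite {n. \<forall>i<m. F n i = f m i}"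
    "\<And>m i. i < m \<Longrightarrow> f (Suc m) i = f m i" by blast
  have stable: "f m i = f (Suc i) i" if "i < m" for m i
    using that
  proof (induction m)
    case (Suc m)
    then show ?case using f(2)[of i m] by (cases "i = m") auto
  qed simp
  have "infinite {n. \<forall>i<m. F n i = f (Suc i) i}" for m
    using f(1)[of m] stable[of _ m] by (simp cong: conj_cong)
  then show ?thesis by (intro exI[of _ "\<lambda>i. f (Suc i) i"] allI)
qed

section \<open>Certificates\<close>

text \<open>A pattern is the sequence of binary digits of a number \<open>w\<close>, arranged by \<open>prod_encode\<close> and
  continued with period \<open>M\<close>. The number \<open>s\<close> codes the shape and also bounds its coordinates. Below,
  \<open>tori\<close> counts the valid patterns of small period, and \<open>boxes\<close> the patterns that are valid on a
  square of side \<open>N\<close>, where \<open>M\<close> is so large that the periodicity plays no role.\<close>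

definition bit_at :: "nat \<Rightarrow> nat \<Rightarrow> nat" where
  "bit_at w i = w div 2 ^ i mod 2"

definition cell :: "nat \<Rightarrow> nat \<Rightarrow> nat \<Rightarrow> nat \<Rightarrow> nat" where
  "cell w M x y = bit_at w (prod_encode (x mod M, y mod M))"

text \<open>For \<open>i \<le> x\<close> this is \<open>x + int_decode i\<close>.\<close>

definition offset :: "nat \<Rightarrow> nat \<Rightarrow> nat" where
  "offset x i = x + (1 - i mod 2) * (i div 2) - i mod 2 * (Suc i div 2)"

definition ones_around :: "nat \<Rightarrow> nat \<Rightarrow> nat \<Rightarrow> nat \<Rightarrow> nat \<Rightarrow> nat" where
  "ones_around w M s x y =
    (\<Sum>i<s. \<Sum>j<s. bit_at s (prod_encode (i, j)) * cell w M (offset x i) (offset y j))"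

text \<open>Truncated subtraction in both orders: the absolute difference between the actual and the
  required count.\<close>

definition deficit :: "nat \<Rightarrow> nat \<Rightarrow> nat \<Rightarrow> nat \<Rightarrow> nat \<Rightarrow> nat \<Rightarrow> nat \<Rightarrow> nat" where
  "deficit w M s b a x y =
    (ones_around w M s x y - (cell w M x y * b + (1 - cell w M x y) * a)) +
    ((cell w M x y * b + (1 - cell w M x y) * a) - ones_around w M s x y)"

text \<open>The shift by s keeps cells with negative offsets inside the natural numbers.\<close>

definition total_deficit :: "nat \<Rightarrow> nat \<Rightarrow> nat \<Rightarrow> nat \<Rightarrow> nat \<Rightarrow> nat \<Rightarrow> nat" where
  "total_deficit w M n s b a = (\<Sum>x<n. \<Sum>y<n. deficit w M s b a (x + s) (y + s))"

text \<open>One parameter N bounds both period and pattern, so that a search over N meets every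
  pair.\<close>

definition tori :: "nat \<Rightarrow> nat \<Rightarrow> nat \<Rightarrow> nat \<Rightarrow> nat" where
  "tori N s b a = (\<Sum>n<N. \<Sum>w<N. 1 - total_deficit w (Suc n) (Suc n) s b a)"

definition boxes :: "nat \<Rightarrow> nat \<Rightarrow> nat \<Rightarrow> nat \<Rightarrow> nat" where
  "boxes N s b a = (let K = Suc (N + 2 * s) in
    \<Sum>w<2 ^ Suc (prod_encode (K, K)). 1 - total_deficit w K N s b a)"

lemma bit_at_set_decode: "bit_at w i = (if i \<in> set_decode w then 1 else 0)"
  by (auto simp: bit_at_def set_decode_def odd_iff_mod_2_eq_one)

lemma cell_cases: "cell w M x y = 0 \<or> cell w M x y = 1"
  by (simp add: cell_def bit_at_set_decode)

lemma offset_int: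
  assumes "i \<le> x"
  shows "int (offset x i) = int x + int_decode i"
proof (cases "even i")
  case True
  then show ?thesis by (simp add: offset_def int_decode_def sum_decode_def)
next
  case False
  then obtain k where "i = 2 * k + 1" by (rule oddE)
  then show ?thesis using assms by (simp add: offset_def int_decode_def sum_decode_def)
qed

lemma deficit_eq_0_iff:
  "deficit w M s b a x y = 0 \<longleftrightarrow> ones_around w M s x y = (if cell w M x y = 1 then b else a)"
  using cell_cases[of w M x y] by (auto simp: deficit_def)

lemma total_deficit_eq_0_iff:
  "total_deficit w M n s b a = 0 \<longleftrightarrow> (\<forall>x<n. \<forall>y<n. ones_around w M s (x + s) (y + s) =
    (if cell w M (x + s) (y + s) = 1 then b else a))"
  unfolding total_deficit_def by (simp add: deficit_eq_0_iff Ball_def)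

lemma less_set_decode: "i \<in> set_decode w \<Longrightarrow> i < w"
proof -
  assume "i \<in> set_decode w"
  then have "odd (w div 2 ^ i)" by (simp add: set_decode_def)
  then have "w div 2 ^ i \<noteq> 0" by (metis even_zero)
  then have "2 ^ i \<le> w" by (simp add: div_eq_0_iff not_less)
  then show "i < w" using less_exp[of i] by linarith
qed

text \<open>A coordinate is at most the code of its pair, and that code, being the position of a
  binary one, is less than the number.\<close>

lemma int_encode_less_shape_encode:
  assumes "finite D" "d \<in> D"
  shows "prod_encode (int_encode (fst d), int_encode (snd d)) \<in> set_decode (shape_encode D)"
    and "int_encode (fst d) < shape_encode D" "int_encode (snd d) < shape_encode D"
proof -
  show *: "prod_encode (int_encode (fst d), int_encode (snd d)) \<in> set_decode (shape_encode D)"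
    using assms by (simp add: shape_encode_def int_pair_encode_def)
  show "int_encode (fst d) < shape_encode D" "int_encode (snd d) < shape_encode D"
    by (rule le_less_trans[OF le_prod_encode_1 less_set_decode[OF *]],
        rule le_less_trans[OF le_prod_encode_2 less_set_decode[OF *]])
qed

lemma offset_le: "offset x i \<le> x + i"
proof -
  have "(1 - i mod 2) * (i div 2) \<le> 1 * i" by (rule mult_mono) auto
  then show ?thesis by (simp add: offset_def)
qed

lemma offset_int_encode:
  assumes "finite D" "d \<in> D"
  shows "(int (offset (x + shape_encode D) (int_encode (fst d))),
      int (offset (y + shape_encode D) (int_encode (snd d)))) =
    (int (x + shape_encode D), int (y + shape_encode D)) + d"
  using int_encode_less_shape_encode[OF assms] by (simp add: offset_int prod_eq_iff)

lemma ones_around_shape_encode: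
  assumes "finite D"
  shows "ones_around w M (shape_encode D) x y =
    (\<Sum>d\<in>D. cell w M (offset x (int_encode (fst d))) (offset y (int_encode (snd d))))"
proof -
  define s where "s = shape_encode D"
  define \<phi> where "\<phi> d = (int_encode (fst d), int_encode (snd d))" for d
  have inj: "inj_on \<phi> D" by (auto simp: inj_on_def \<phi>_def int_encode_eq)
  have bit: "bit_at s (prod_encode p) = (if p \<in> \<phi> ` D then 1 else 0)" for p
  proof -
    have "prod_encode p \<in> set_decode s \<longleftrightarrow> p \<in> \<phi> ` D"
      using assms by (auto simp: s_def shape_encode_def int_pair_encode_def \<phi>_def image_iff)
    then show ?thesis by (simp add: bit_at_set_decode)
  qed
  have sub: "\<phi> ` D \<subseteq> {..<s} \<times> {..<s}"
    using int_encode_less_shape_encode[OF assms] by (auto simp: \<phi>_def s_def)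
  have "ones_around w M s x y = (\<Sum>p\<in>{..<s} \<times> {..<s}.
      bit_at s (prod_encode p) * cell w M (offset x (fst p)) (offset y (snd p)))"
    unfolding ones_around_def by (simp add: sum.cartesian_product case_prod_unfold)
  also have "\<dots> = (\<Sum>p\<in>\<phi> ` D. bit_at s (prod_encode p) * cell w M (offset x (fst p)) (offset y (snd p)))"
    by (rule sum.mono_neutral_right) (use sub bit in auto)
  also have "\<dots> = (\<Sum>d\<in>D. cell w M (offset x (fst (\<phi> d))) (offset y (snd (\<phi> d))))"
    by (subst sum.reindex[OF inj]) (simp add: bit)
  finally show ?thesis by (simp add: \<phi>_def s_def)
qed

definition pattern_code :: "nat \<Rightarrow> (int \<times> int \<Rightarrow> nat) \<Rightarrow> nat" where
  "pattern_code K c = set_encode (prod_encode ` {(x, y). x < K \<and> y < K \<and> c (int x, int y) = 1})"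

lemma finite_pattern: "finite {(x :: nat, y :: nat). x < K \<and> y < K \<and> P x y}"
  by (rule finite_subset[of _ "{..<K} \<times> {..<K}"]) auto

lemma cell_pattern_code:
  assumes "x mod K < K" "y mod K < K" "\<And>z. c z = 0 \<or> c z = 1"
  shows "cell (pattern_code K c) K x y = c (int (x mod K), int (y mod K))"
proof -
  have "prod_encode (x mod K, y mod K) \<in> set_decode (pattern_code K c) \<longleftrightarrow>
      c (int (x mod K), int (y mod K)) = 1"
    using assms(1,2) unfolding pattern_code_def
    by (subst set_encode_inverse) (auto intro!: finite_imageI finite_pattern simp: image_iff)
  then show ?thesis
    using assms(3)[of "(int (x mod K), int (y mod K))"] by (auto simp: cell_def bit_at_set_decode)
qed

lemma triangle_mono: "m \<le> n \<Longrightarrow> triangle m \<le> triangle n"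
  by (induction rule: dec_induct) auto

text \<open>The pairing is monotone, so every cell of the square has a code at most
  \<open>prod_encode (K, K)\<close>.\<close>

lemma pattern_code_less: "pattern_code K c < 2 ^ Suc (prod_encode (K, K))"
proof -
  let ?A = "prod_encode ` {(x, y). x < K \<and> y < K \<and> c (int x, int y) = 1}"
  have "?A \<subseteq> {..<Suc (prod_encode (K, K))}"
    by (auto simp: prod_encode_def less_Suc_eq_le intro!: add_mono triangle_mono)
  then have "set_encode ?A \<le> (\<Sum>i<Suc (prod_encode (K, K)). 2 ^ i)"
    unfolding set_encode_def by (intro sum_mono2) auto
  also have "\<dots> < 2 ^ Suc (prod_encode (K, K))"
    unfolding lessThan_atLeast0 sum_power2 by simp
  finally show ?thesis by (simp add: pattern_code_def)
qed

section \<open>Soundness and completeness of the certificates\<close>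

lemma tori_pos_imp_covering:
  assumes "finite D" "tori N (shape_encode D) b a > 0"
  shows "\<exists>c. covering D b a c"
proof -
  define s where "s = shape_encode D"
  obtain n w where nw: "total_deficit w (Suc n) (Suc n) s b a = 0"
    using assms(2) unfolding tori_def s_def
    by (metis (no_types, lifting) sum.neutral zero_less_diff gr0I less_irrefl diff_is_0_eq' Suc_leI One_nat_def)
  define M where "M = Suc n"
  define c where "c z = cell w M (nat (fst z mod int M)) (nat (snd z mod int M))" for z
  have M: "int M > 0" by (simp add: M_def)
  have cong: "c z = c z'" if "fst z mod int M = fst z' mod int M" "snd z mod int M = snd z' mod int M" for z z'
    using that by (simp add: c_def)
  have cell: "cell w M x y = c (int x, int y)" for x y
    unfolding cell_def c_def by (simp add: nat_mod_distrib)
  have "(\<Sum>d\<in>D. c (u + d)) = (if c u = 1 then b else a)" for u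
  proof -
    \<comment> \<open>Reduction of u - (s, s), so that (x + s, y + s) is congruent to u modulo the
      period.\<close>
    define x y where "x = nat ((fst u - int s) mod int M)" and "y = nat ((snd u - int s) mod int M)"
    have xy: "x < M" "y < M" unfolding x_def y_def using M by (simp_all add: nat_less_iff)
    have x: "int x = (fst u - int s) mod int M" "int y = (snd u - int s) mod int M"
      unfolding x_def y_def using M by simp_all
    have shift: "c ((int (x + s), int (y + s)) + d) = c (u + d)" for d
    proof (rule cong)
      have "((i - int s) mod int M + int s + j) mod int M = (i + j) mod int M" for i j
        using mod_add_left_eq[of "i - int s" "int M" "int s + j"] by (simp add: add.assoc)
      then show "fst ((int (x + s), int (y + s)) + d) mod int M = fst (u + d) mod int M"
        "snd ((int (x + s), int (y + s)) + d) mod int M = snd (u + d) mod int M"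
        by (simp_all add: x)
    qed
    have "ones_around w M s (x + s) (y + s) = (\<Sum>d\<in>D. c (u + d))"
      unfolding s_def ones_around_shape_encode[OF assms(1)]
    proof (rule sum.cong[OF refl])
      fix d assume "d \<in> D"
      then show "cell w M (offset (x + shape_encode D) (int_encode (fst d)))
          (offset (y + shape_encode D) (int_encode (snd d))) = c (u + d)"
        by (simp only: cell offset_int_encode[OF assms(1)] shift[unfolded s_def])
    qed
    moreover have "cell w M (x + s) (y + s) = c u"
      using shift[of 0] by (simp add: cell)
    moreover have "ones_around w M s (x + s) (y + s) = (if cell w M (x + s) (y + s) = 1 then b else a)"
      using nw xy unfolding total_deficit_eq_0_iff M_def by blast
    ultimately show ?thesis by simp
  qed
  moreover have "c u \<in> {0, 1}" for u using cell_cases unfolding c_def by blast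
  ultimately show ?thesis using covering_iff[OF assms(1)] by blast
qed

lemma periodic_covering_imp_tori_pos:
  assumes "finite D" and cov: "covering D b a c" and "n > 0"
    and per: "\<And>z x. c (z + smul (int n) x) = c z"
  shows "\<exists>N. tori N (shape_encode D) b a > 0"
proof -
  define s where "s = shape_encode D"
  define w where "w = pattern_code n c"
  have c01: "c z = 0 \<or> c z = 1" for z using cov unfolding covering_def by blast
  have cell: "cell w n x y = c (int x, int y)" for x y
  proof -
    have "cell w n x y = c (int (x mod n), int (y mod n))"
      unfolding w_def by (rule cell_pattern_code) (use \<open>n > 0\<close> c01 in auto)
    also have "(int x, int y) = (int (x mod n), int (y mod n)) +
        smul (int n) (int (x div n), int (y div n))"
      by (simp add: smul_def flip: of_nat_mult of_nat_add)
    then have "c (int (x mod n), int (y mod n)) = c (int x, int y)" by (simp only: per)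
    finally show ?thesis .
  qed
  have "ones_around w n s (x + s) (y + s) = (if cell w n (x + s) (y + s) = 1 then b else a)" for x y
  proof -
    have "ones_around w n s (x + s) (y + s) = (\<Sum>d\<in>D. c ((int (x + s), int (y + s)) + d))"
      unfolding s_def ones_around_shape_encode[OF assms(1)]
    proof (rule sum.cong[OF refl])
      fix d assume "d \<in> D"
      then show "cell w n (offset (x + shape_encode D) (int_encode (fst d)))
          (offset (y + shape_encode D) (int_encode (snd d))) =
        c ((int (x + shape_encode D), int (y + shape_encode D)) + d)"
        by (simp only: cell offset_int_encode[OF assms(1)])
    qed
    also have "\<dots> = (if c (int (x + s), int (y + s)) = 1 then b else a)"
      using cov unfolding covering_iff[OF assms(1)] by blast
    finally show ?thesis by (simp only: cell)
  qed
  then have zero: "total_deficit w n n s b a = 0" by (simp add: total_deficit_eq_0_iff)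
  \<comment> \<open>Large enough to exceed both n - 1 and the pattern w.\<close>
  define N where "N = Suc (n + w)"
  have "1 - total_deficit w (Suc (n - 1)) (Suc (n - 1)) s b a \<le>
      (\<Sum>w<N. 1 - total_deficit w (Suc (n - 1)) (Suc (n - 1)) s b a)"
    by (rule member_le_sum) (auto simp: N_def)
  also have "\<dots> \<le> tori N s b a"
    unfolding tori_def by (rule member_le_sum) (auto simp: N_def)
  finally have "tori N s b a > 0" using zero \<open>n > 0\<close> by simp
  then show ?thesis unfolding s_def by blast
qed

lemma covering_imp_boxes_pos:
  assumes "finite D" and cov: "covering D b a c"
  shows "boxes N (shape_encode D) b a > 0"
proof -
  define s where "s = shape_encode D"
  \<comment> \<open>All cells consulted have coordinates below K, so reduction modulo K leaves them
    unchanged.\<close>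
  define K where "K = Suc (N + 2 * s)"
  define w where "w = pattern_code K c"
  have c01: "c z = 0 \<or> c z = 1" for z using cov unfolding covering_def by blast
  have cell: "cell w K x y = c (int x, int y)" if "x < K" "y < K" for x y
    using cell_pattern_code[of x K y c, OF _ _ c01] that by (simp add: w_def)
  have "ones_around w K s (x + s) (y + s) = (if cell w K (x + s) (y + s) = 1 then b else a)"
    if "x < N" "y < N" for x y
  proof -
    have "ones_around w K s (x + s) (y + s) = (\<Sum>d\<in>D. c ((int (x + s), int (y + s)) + d))"
      unfolding s_def ones_around_shape_encode[OF assms(1)]
    proof (rule sum.cong[OF refl])
      fix d assume d: "d \<in> D"
      have "offset (x + s) (int_encode (fst d)) < K" "offset (y + s) (int_encode (snd d)) < K"
        using that int_encode_less_shape_encode[OF assms(1) d]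
          offset_le[of "x + s" "int_encode (fst d)"] offset_le[of "y + s" "int_encode (snd d)"]
        by (simp_all add: K_def s_def)
      then show "cell w K (offset (x + shape_encode D) (int_encode (fst d)))
          (offset (y + shape_encode D) (int_encode (snd d))) =
        c ((int (x + shape_encode D), int (y + shape_encode D)) + d)"
        using offset_int_encode[OF assms(1) d, of x y] by (simp add: cell s_def)
    qed
    also have "\<dots> = (if c (int (x + s), int (y + s)) = 1 then b else a)"
      using cov unfolding covering_iff[OF assms(1)] by blast
    also have "c (int (x + s), int (y + s)) = cell w K (x + s) (y + s)"
      using that cell[of "x + s" "y + s"] by (simp add: K_def)
    finally show ?thesis .
  qed
  then have "total_deficit w K N s b a = 0" by (simp add: total_deficit_eq_0_iff)
  moreover have "1 - total_deficit w K N s b a \<le> boxes N s b a"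
    unfolding boxes_def Let_def K_def[symmetric]
    by (rule member_le_sum) (use pattern_code_less in \<open>auto simp: w_def simp del: power_Suc\<close>)
  ultimately show ?thesis by (simp add: s_def)
qed

text \<open>Each constraint involves finitely many cells, on which the limit agrees with valid
  patterns on arbitrarily large boxes.\<close>

lemma boxes_pos_imp_covering:
  assumes "finite D" and pos: "\<And>N. boxes N (shape_encode D) b a > 0"
  shows "\<exists>c. covering D b a c"
proof -
  define s where "s = shape_encode D"
  define K where "K N = Suc (N + 2 * s)" for N
  have "\<exists>w. total_deficit w (K N) N s b a = 0" for N
    using pos[of N] unfolding boxes_def Let_def s_def[symmetric] K_def[symmetric]
    by (metis (no_types, lifting) sum.neutral gr0I less_irrefl diff_is_0_eq' Suc_leI One_nat_def)
  then obtain w where w: "\<And>N. total_deficit (w N) (K N) N s b a = 0" by metis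
  \<comment> \<open>Half the side moves the origin to the centre of the box, so every u is
    eventually inside.\<close>
  define h where "h N = int (N div 2)" for N
  define f where "f N z = cell (w N) (K N) (nat (fst z + int s + h N)) (nat (snd z + int s + h N))" for N z
  have loc: "(\<Sum>d\<in>D. f N (u + d)) = (if f N u = 1 then b else a)"
    if "nat (2 * \<bar>fst u\<bar> + 2 * \<bar>snd u\<bar> + 2) \<le> N" for N u
  proof -
    define x y where "x = nat (fst u + h N)" and "y = nat (snd u + h N)"
    have xy: "int x = fst u + h N" "int y = snd u + h N" "x < N" "y < N"
      using that unfolding x_def y_def h_def by auto
    have "ones_around (w N) (K N) s (x + s) (y + s) = (\<Sum>d\<in>D. f N (u + d))"
      unfolding s_def ones_around_shape_encode[OF assms(1)]
    proof (rule sum.cong[OF refl])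
      fix d assume d: "d \<in> D"
      have "offset (x + s) (int_encode (fst d)) = nat (fst (u + d) + int s + h N)"
        "offset (y + s) (int_encode (snd d)) = nat (snd (u + d) + int s + h N)"
        using offset_int_encode[OF assms(1) d, of x y] xy
        by (simp_all add: s_def prod_eq_iff nat_eq_iff2 algebra_simps)
      then show "cell (w N) (K N) (offset (x + shape_encode D) (int_encode (fst d)))
          (offset (y + shape_encode D) (int_encode (snd d))) = f N (u + d)"
        by (simp add: f_def s_def)
    qed
    moreover have "cell (w N) (K N) (x + s) (y + s) = f N u"
    proof -
      have "x + s = nat (fst u + int s + h N)" "y + s = nat (snd u + int s + h N)"
        using xy by linarith+
      then show ?thesis by (simp add: f_def)
    qed
    moreover have "ones_around (w N) (K N) s (x + s) (y + s) =
        (if cell (w N) (K N) (x + s) (y + s) = 1 then b else a)"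
      using w[of N] xy unfolding total_deficit_eq_0_iff by blast
    ultimately show ?thesis by simp
  qed
  define dec where "dec i = map_prod int_decode int_decode (prod_decode i)" for i
  have dec: "dec (int_pair_encode z) = z" for z
    by (simp add: dec_def int_pair_encode_def)
  obtain c where c: "\<And>m. infinite {N. \<forall>i<m. f N (dec i) = c i}"
    using ex_limit_sequence[of "{0, 1}" "\<lambda>N i. f N (dec i)"] cell_cases unfolding f_def by auto
  define c' where "c' z = c (int_pair_encode z)" for z
  have ex: "\<exists>N\<ge>m. \<forall>z\<in>Z. f N z = c' z" if "finite Z" for Z m
  proof -
    have "finite (int_pair_encode ` Z)" using that by simp
    then obtain k where k: "\<forall>i\<in>int_pair_encode ` Z. i < k"
      unfolding finite_nat_set_iff_bounded by (elim exE)
    obtain N where N: "N > m" "\<forall>i<k. f N (dec i) = c i"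
      using c[of k] unfolding infinite_nat_iff_unbounded by blast
    have "f N z = c' z" if "z \<in> Z" for z
      using N(2)[rule_format, of "int_pair_encode z"] k that by (simp add: dec c'_def)
    then show ?thesis using N(1) less_imp_le by blast
  qed
  have "(\<Sum>d\<in>D. c' (u + d)) = (if c' u = 1 then b else a)" for u
  proof -
    obtain N where N: "N \<ge> nat (2 * \<bar>fst u\<bar> + 2 * \<bar>snd u\<bar> + 2)"
      "\<forall>z\<in>insert u ((+) u ` D). f N z = c' z"
      using ex[of "insert u ((+) u ` D)"] assms(1) by blast
    have "(\<Sum>d\<in>D. c' (u + d)) = (\<Sum>d\<in>D. f N (u + d))" using N(2) by (intro sum.cong) auto
    also have "\<dots> = (if f N u = 1 then b else a)" by (rule loc[OF N(1)])
    finally show ?thesis using N(2) by simp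
  qed
  moreover have "c' u \<in> {0, 1}" for u
  proof -
    obtain N where "f N u = c' u" using ex[of "{u}" 0] by auto
    then show ?thesis using cell_cases unfolding f_def by (metis insertCI)
  qed
  ultimately show ?thesis using covering_iff[OF assms(1)] by blast
qed

section \<open>The algorithm\<close>

lemma recursive_prod_encode:
  assumes "recursive k f" "recursive k g"
  shows "recursive k (\<lambda>xs. prod_encode (f xs, g xs))"
  unfolding prod_encode_def triangle_def prod.case
  by (intro recursive_arith assms)

lemma recursive_bit_at:
  assumes "recursive k f" "recursive k g"
  shows "recursive k (\<lambda>xs. bit_at (f xs) (g xs))"
  unfolding bit_at_def by (intro recursive_arith assms)

lemma recursive_cell:
  assumes "recursive k w" "recursive k M" "recursive k x" "recursive k y"
  shows "recursive k (\<lambda>xs. cell (w xs) (M xs) (x xs) (y xs))"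
  unfolding cell_def by (intro recursive_bit_at recursive_prod_encode recursive_arith assms)

lemma recursive_offset:
  assumes "recursive k f" "recursive k g"
  shows "recursive k (\<lambda>xs. offset (f xs) (g xs))"
  unfolding offset_def by (intro recursive_arith assms)

lemma recursive_ones_around:
  assumes "recursive k w" "recursive k M" "recursive k s" "recursive k x" "recursive k y"
  shows "recursive k (\<lambda>xs. ones_around (w xs) (M xs) (s xs) (x xs) (y xs))"
  unfolding ones_around_def
  by (intro recursive_sum recursive_mult recursive_bit_at recursive_prod_encode recursive_cell
      recursive_offset recursive_hd recursive_hd_tl recursive_tl[OF recursive_tl]
      recursive_tl assms) simp_all

lemma recursive_deficit:
  assumes "recursive k w" "recursive k M" "recursive k s" "recursive k b" "recursive k a"
    "recursive k x" "recursive k y"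
  shows "recursive k (\<lambda>xs. deficit (w xs) (M xs) (s xs) (b xs) (a xs) (x xs) (y xs))"
  unfolding deficit_def by (intro recursive_ones_around recursive_cell recursive_arith assms)

lemma recursive_total_deficit:
  assumes "recursive k w" "recursive k M" "recursive k n" "recursive k s" "recursive k b" "recursive k a"
  shows "recursive k (\<lambda>xs. total_deficit (w xs) (M xs) (n xs) (s xs) (b xs) (a xs))"
  unfolding total_deficit_def
  by (intro recursive_sum recursive_add recursive_deficit recursive_hd recursive_hd_tl
      recursive_tl[OF recursive_tl] recursive_tl assms) simp_all

lemma recursive_tori:
  assumes "recursive k N" "recursive k s" "recursive k b" "recursive k a"
  shows "recursive k (\<lambda>xs. tori (N xs) (s xs) (b xs) (a xs))"
  unfolding tori_def
  by (intro recursive_sum recursive_diff recursive_const recursive_total_deficit recursive_Suc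
      recursive_hd recursive_hd_tl recursive_tl[OF recursive_tl] recursive_tl assms) simp_all

lemma recursive_boxes:
  assumes "recursive k N" "recursive k s" "recursive k b" "recursive k a"
  shows "recursive k (\<lambda>xs. boxes (N xs) (s xs) (b xs) (a xs))"
  unfolding boxes_def Let_def
  by (intro recursive_sum recursive_diff recursive_const recursive_total_deficit recursive_Suc
      recursive_power recursive_prod_encode recursive_add recursive_mult
      recursive_hd recursive_tl assms) simp_all

theorem theorem15:
  "\<exists>alg. \<forall>(D :: (int \<times> int) set) (b :: nat) (a :: nat).
     finite D \<and>
     line_factors_at_most_one_direction
       (char_laurent D - laurent_const (of_nat b - of_nat a))
     \<longrightarrow> run alg [shape_encode D, b, a] = Some (if \<exists>c. covering D b a c then 1 else 0)"
proof -
  define t where "t xs = tori (xs ! 0) (xs ! 1) (xs ! 2) (xs ! 3)" for xs :: "nat list"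
  \<comment> \<open>Zero exactly when some torus is found or no valid box exists; \<open>g\<close>
    then tells which.\<close>
  define h where "h xs = (1 - t xs) * boxes (xs ! 0) (xs ! 1) (xs ! 2) (xs ! 3)" for xs :: "nat list"
  define g where "g xs = 1 - (1 - t xs)" for xs :: "nat list"
  have t: "recursive 4 t" unfolding t_def by (intro recursive_tori recursive_nth) simp_all
  have h: "recursive (Suc 3) h"
    using t unfolding h_def by (intro recursive_mult recursive_diff recursive_const recursive_boxes recursive_nth) simp_all
  have g: "recursive (Suc 3) g"
    using t unfolding g_def by (intro recursive_diff recursive_const) simp_all
  obtain r where r: "\<And>xs. length xs = 3 \<Longrightarrow> \<exists>n. h (n # xs) = 0 \<Longrightarrow>
      \<exists>n. h (n # xs) = 0 \<and> run r xs = Some (g (n # xs))"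
    using recursive_at_zero[OF h g] by blast
  have "run r [shape_encode D, b, a] = Some (if \<exists>c. covering D b a c then 1 else 0)"
    if D: "finite D" and one: "line_factors_at_most_one_direction
      (char_laurent D - laurent_const (of_nat b - of_nat a))" for D b a
  proof -
    let ?xs = "[shape_encode D, b, a]"
    have t_xs: "t (N # ?xs) = tori N (shape_encode D) b a" for N
      by (simp add: t_def numeral_eq_Suc)
    have h_xs: "h (N # ?xs) = 0 \<longleftrightarrow>
        tori N (shape_encode D) b a > 0 \<or> boxes N (shape_encode D) b a = 0" for N
      unfolding h_def t_xs by (auto simp: numeral_eq_Suc)
    \<comment> \<open>Termination: if a covering exists, the hypothesis on factors supplies a doubly
      periodic one; if none exists, compactness supplies an empty box count.\<close>
    have "\<exists>N. h (N # ?xs) = 0"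
    proof (cases "\<exists>c. covering D b a c")
      case True
      then obtain c where c: "covering D b a c" by blast
      obtain v where v: "v \<noteq> 0" "\<And>z. c (z + v) = c z"
        using covering_periodic[OF D c one] by blast
      obtain c' n where "n > 0" "covering D b a c'" "\<And>z x. c' (z + smul (int n) x) = c' z"
        using covering_doubly_periodic[OF D c v] by blast
      then show ?thesis
        unfolding h_xs using periodic_covering_imp_tori_pos[OF D] by blast
    next
      case False
      then show ?thesis
        unfolding h_xs using boxes_pos_imp_covering[OF D, of b a] by auto
    qed
    then obtain N where N: "h (N # ?xs) = 0" "run r ?xs = Some (g (N # ?xs))"
      using r[of ?xs] by auto
    \<comment> \<open>A torus proves existence; without one the search stopped at an empty box
      count, which refutes it.\<close>
    show ?thesis
    proof (cases "tori N (shape_encode D) b a > 0")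
      case True
      then show ?thesis
        using tori_pos_imp_covering[OF D True] N(2) by (simp add: g_def t_xs)
    next
      case False
      then have "\<nexists>c. covering D b a c"
        using N(1) covering_imp_boxes_pos[OF D] unfolding h_xs by (metis less_irrefl)
      then show ?thesis using N(2) False by (simp add: g_def t_xs)
    qed
  qed
  then show ?thesis by blast
qed

end
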